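(* Let $1<p<q<p^*$. For every $c>0$ the maximization problem \[ \sup\Big\{\mu_{p,q}(\Omega)\ :\ \Omega\subset\mathbb{R}^N \text{ nonempty, open, bounded and convex},\ \mathrm{diam}(\Omega)\ge c\Big\} \] admits a solution. Equivalently, there exists a nonempty open bounded convex set $\mathcal{K}\subset\mathbb{R}^N$ such that \[ \mu_{p,q}(\Omega)\,\big(\mathrm{diam}(\Omega)\big)^{p+\frac{Np}{q}-N}\le \mu_{p,q}(\mathcal{K})\,\big(\mathrm{diam}(\mathcal{K})\big)^{p+\frac{Np}{q}-N} \] for every nonempty open bounded convex set $\Omega\subset\mathbb{R}^N$.
   Context: For $1<p<\infty$, set $p^*=\frac{Np}{N-p}$ if $p<N$ and $p^*=+\infty$ if $p\ge N$. For an open bounded Lipschitz set $\Omega\subset\mathbb{R}^N$ and $1<q<p^*$, define \[ \mu_{p,q}(\Omega)=\inf_{v\in W^{1,p}(\Omega)\setminus\{0\}}\left\{\frac{\int_\Omega|\nabla v|^p\,dx}{\left(\int_\Omega|v|^q\,dx\right)^{p/q}}\ :\ \int_\Omega|v|^{q-2}v\,dx=0\right\}. \] $\mathrm{diam}$ denotes the diameter. *)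

theory Defs
  imports "HOL-Analysis.Analysis"
begin

definition sobolev_exponent :: "nat \<Rightarrow> real \<Rightarrow> ereal" where
  "sobolev_exponent N p = (if p < real N then ereal (real N * p / (real N - p)) else \<infinity>)"

(* The number frechet_derivative f (at x) b is the partial derivative of f at x
   in the coordinate direction b. *)
primrec Ck :: "nat \<Rightarrow> ('a::euclidean_space \<Rightarrow> real) \<Rightarrow> bool" where
  "Ck 0 f \<longleftrightarrow> continuous_on UNIV f"
| "Ck (Suc k) f \<longleftrightarrow>
     (\<forall>x. f differentiable (at x)) \<and> (\<forall>b\<in>Basis. Ck k (\<lambda>x. frechet_derivative f (at x) b))"

(* Elements of \<open>C_c^\<infinity>(\<Omega>)\<close> are extended by zero to the whole space. *)
definition test_functions :: "'a::euclidean_space set \<Rightarrow> ('a \<Rightarrow> real) set" where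
  "test_functions \<Omega> =
     {\<phi>. (\<forall>k. Ck k \<phi>) \<and> compact (closure {x. \<phi> x \<noteq> 0}) \<and> closure {x. \<phi> x \<noteq> 0} \<subseteq> \<Omega>}"

(* Functions, not classes modulo equality almost everywhere; values outside \<open>\<Omega>\<close> are irrelevant. *)
definition Lp :: "real \<Rightarrow> 'a::euclidean_space set \<Rightarrow> ('a \<Rightarrow> 'b::euclidean_space) set" where
  "Lp p \<Omega> = {f \<in> borel_measurable (lebesgue_on \<Omega>).
                integrable (lebesgue_on \<Omega>) (\<lambda>x. norm (f x) powr p)}"

(* The integrals are finite whenever v and g are locally integrable on \<open>\<Omega>\<close>. *)
definition has_weak_gradient ::
    "'a::euclidean_space set \<Rightarrow> ('a \<Rightarrow> real) \<Rightarrow> ('a \<Rightarrow> 'a) \<Rightarrow> bool" where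
  "has_weak_gradient \<Omega> v g \<longleftrightarrow>
     (\<forall>\<phi>\<in>test_functions \<Omega>. \<forall>b\<in>Basis.
        (\<integral>x. v x * frechet_derivative \<phi> (at x) b \<partial>lebesgue_on \<Omega>)
          = - (\<integral>x. (g x \<bullet> b) * \<phi> x \<partial>lebesgue_on \<Omega>))"

(* The graph of the weak gradient on \<open>W^{1,p}(\<Omega>)\<close>: pairs (v, g) with v in the Sobolev space
   and g a representative of its weak gradient, which is unique almost everywhere. *)
definition W1p_graph :: "real \<Rightarrow> 'a::euclidean_space set \<Rightarrow> (('a \<Rightarrow> real) \<times> ('a \<Rightarrow> 'a)) set" where
  "W1p_graph p \<Omega> = {(v, g). v \<in> Lp p \<Omega> \<and> g \<in> Lp p \<Omega> \<and> has_weak_gradient \<Omega> v g}"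

(* Meant for nonempty open bounded Lipschitz \<open>\<Omega>\<close> (in particular, convex ones) and
   \<open>1 < q < p^*\<close>: then the Sobolev embedding makes \<open>|v|^q\<close> integrable, and the infimum is over
   a nonempty set of nonnegative reals. Nonzero means nonzero as an element of \<open>W^{1,p}(\<Omega>)\<close>. *)
definition mu :: "real \<Rightarrow> real \<Rightarrow> 'a::euclidean_space set \<Rightarrow> real" where
  "mu p q \<Omega> = Inf
     {(\<integral>x. norm (g x) powr p \<partial>lebesgue_on \<Omega>)
        / (\<integral>x. \<bar>v x\<bar> powr q \<partial>lebesgue_on \<Omega>) powr (p / q) | v g.
      (v, g) \<in> W1p_graph p \<Omega> \<and> \<not> (AE x in lebesgue_on \<Omega>. v x = 0) \<and>
      (\<integral>x. \<bar>v x\<bar> powr (q - 2) * v x \<partial>lebesgue_on \<Omega>) = 0}"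

definition convex_domain :: "'a::euclidean_space set \<Rightarrow> bool" where
  "convex_domain \<Omega> \<longleftrightarrow> \<Omega> \<noteq> {} \<and> open \<Omega> \<and> bounded \<Omega> \<and> convex \<Omega>"

end

theory Submission imports Defs "HOL-Complex_Analysis.Great_Picard" begin

text \<open>The quantity \<open>F \<Omega> = mu p q \<Omega> * diameter \<Omega> powr s\<close>, \<open>s = p + N p / q - N > 0\<close>, is invariant under
  translations and dilations, so both claims follow once \<open>F\<close> is maximized, and one may normalize
  the diameter to 1. A linear test function in a nearly diametral direction gives
  \<open>mu p q \<Omega> \<le> C |\<Omega>| powr (1 - p / q)\<close>; as \<open>p < q\<close>, the volumes along a maximizing sequence stay away from 0, and
  Blaschke's selection theorem yields a limit convex body with nonempty interior \<open>K\<close>.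
  Slightly contracted, the sets of the sequence exhaust \<open>K\<close> from inside. An admissible function on
  \<open>K\<close>, restricted and recentred by a constant \<open>c\<close>, is a competitor on these sets; Fatou's lemma,
  together with the fact that \<open>\<integral>|v - c|^q\<close> is minimal at \<open>c = 0\<close> for centred \<open>v\<close>, shows that \<open>mu\<close> is
  upper semicontinuous along them.\<close>

subsection \<open>Affine changes of variables\<close>

text \<open>Upper semicontinuity needs competitors to pass from the limit body to the approximating
  sets. Restriction does this without raising the gradient energy and without extension operators or
  uniform Sobolev constants, but only for sets inside the limit. Hausdorff convergence merely places
  them in small neighbourhoods of it; hence the contraction towards an interior point, whose effect
  on \<open>mu\<close> is an explicit factor tending to 1. Restriction destroys the constraint, and
  the constant that restores it is not controlled in advance, so the denominator might drop;
  minimality at the centred position excludes this. Integrability of |v|^q is not derived from an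
  embedding: if it fails, the Bochner integral and with it the quotient is 0. Denominators are
  therefore bounded below through nonnegative extended integrals, and a supremum equal to 0 is
  treated separately. The condition q < p^* enters as positivity of the exponent s.\<close>

lemma lebesgue_affine_scaleR:
  fixes a :: "'a::euclidean_space"
  assumes "t \<noteq> 0"
  shows "lebesgue = density (distr lebesgue lebesgue (\<lambda>x. a + t *\<^sub>R x)) (\<lambda>_. ennreal (\<bar>t\<bar> ^ DIM('a)))"
    and affine_scaleR_measurable_lebesgue: "(\<lambda>x. a + t *\<^sub>R x) \<in> lebesgue \<rightarrow>\<^sub>M lebesgue"
proof -
  have "(\<lambda>x::'a. a + t *\<^sub>R x) = (\<lambda>x. a + (\<Sum>j\<in>Basis. (t * (x \<bullet> j)) *\<^sub>R j))"
    by (simp add: euclidean_representation flip: scaleR_sum_right scaleR_scaleR)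
  then show "lebesgue = density (distr lebesgue lebesgue (\<lambda>x. a + t *\<^sub>R x)) (\<lambda>_. ennreal (\<bar>t\<bar> ^ DIM('a)))"
    and "(\<lambda>x. a + t *\<^sub>R x) \<in> lebesgue \<rightarrow>\<^sub>M lebesgue"
    using lebesgue_affine_euclidean[of "\<lambda>_. t" a] lebesgue_affine_measurable[of "\<lambda>_. t" a] assms
    by simp_all
qed

lemma affine_scaleR_inverse:
  fixes a :: "'a::real_vector"
  assumes "t \<noteq> 0"
  shows "a + t *\<^sub>R ((- (a /\<^sub>R t)) + (1 / t) *\<^sub>R x) = x"
    and "(- (a /\<^sub>R t)) + (1 / t) *\<^sub>R (a + t *\<^sub>R x) = x"
  using assms by (simp_all add: algebra_simps divide_inverse)

lemma lebesgue_measurable_affine_iff: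
  fixes f :: "'a::euclidean_space \<Rightarrow> 'b::{banach,second_countable_topology}"
  assumes "t \<noteq> 0"
  shows "(\<lambda>x. f (a + t *\<^sub>R x)) \<in> borel_measurable lebesgue \<longleftrightarrow> f \<in> borel_measurable lebesgue"
proof
  assume "f \<in> borel_measurable lebesgue"
  then show "(\<lambda>x. f (a + t *\<^sub>R x)) \<in> borel_measurable lebesgue"
    using measurable_compose[OF affine_scaleR_measurable_lebesgue[OF assms]] by blast
next
  assume "(\<lambda>x. f (a + t *\<^sub>R x)) \<in> borel_measurable lebesgue"
  from measurable_compose[OF affine_scaleR_measurable_lebesgue this, of "1/t" "- (a /\<^sub>R t)"]
  show "f \<in> borel_measurable lebesgue"
    using assms by (simp only: affine_scaleR_inverse[OF assms]) simp
qed

lemma lebesgue_integrable_affine_iff: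
  fixes f :: "'a::euclidean_space \<Rightarrow> 'b::{banach,second_countable_topology}"
  assumes "t \<noteq> 0"
  shows "integrable lebesgue (\<lambda>x. f (a + t *\<^sub>R x)) \<longleftrightarrow> integrable lebesgue f"
proof (cases "f \<in> borel_measurable lebesgue")
  case True
  note [measurable] = True affine_scaleR_measurable_lebesgue[OF assms, of a]
  have "integrable lebesgue f \<longleftrightarrow>
      integrable (density (distr lebesgue lebesgue (\<lambda>x. a + t *\<^sub>R x)) (\<lambda>_. ennreal (\<bar>t\<bar> ^ DIM('a)))) f"
    using lebesgue_affine_scaleR[OF assms, of a] by simp
  also have "\<dots> \<longleftrightarrow> integrable lebesgue (\<lambda>x. f (a + t *\<^sub>R x))"
    using assms integrable_scaleR_right[of "inverse (\<bar>t\<bar> ^ DIM('a))" lebesgue "\<lambda>x. \<bar>t\<bar> ^ DIM('a) *\<^sub>R f (a + t *\<^sub>R x)"]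
    by (subst integrable_density) (auto simp: integrable_distr_eq)
  finally show ?thesis by simp
next
  case False
  then show ?thesis
    using lebesgue_measurable_affine_iff[OF assms, of f a] by (metis borel_measurable_integrable)
qed

lemma lebesgue_integral_affine:
  fixes f :: "'a::euclidean_space \<Rightarrow> 'b::{banach,second_countable_topology}"
  assumes "t \<noteq> 0"
  shows "(\<integral>x. f (a + t *\<^sub>R x) \<partial>lebesgue) = (\<integral>x. f x \<partial>lebesgue) /\<^sub>R \<bar>t\<bar> ^ DIM('a)"
proof (cases "integrable lebesgue f")
  case True
  note [measurable] = borel_measurable_integrable[OF True] affine_scaleR_measurable_lebesgue[OF assms, of a]
  have "(\<integral>x. f x \<partial>lebesgue) =
      (\<integral>x. f x \<partial>density (distr lebesgue lebesgue (\<lambda>x. a + t *\<^sub>R x)) (\<lambda>_. ennreal (\<bar>t\<bar> ^ DIM('a))))"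
    using lebesgue_affine_scaleR[OF assms, of a] by simp
  also have "\<dots> = \<bar>t\<bar> ^ DIM('a) *\<^sub>R (\<integral>x. f (a + t *\<^sub>R x) \<partial>lebesgue)"
    by (subst integral_density) (auto simp: integral_distr)
  finally show ?thesis using assms by simp
next
  \<comment> \<open>Both integrals are 0 by convention. The rule thus holds for all f, and Rayleigh
    quotients can be transported without knowing that |v|^q is integrable.\<close>
  case False
  then show ?thesis
    using lebesgue_integrable_affine_iff[OF assms, of f a] by (simp add: not_integrable_integral_eq)
qed

lemma vimage_affine_sets_lebesgue:
  fixes a :: "'a::euclidean_space"
  assumes "t \<noteq> 0" "\<Omega> \<in> sets lebesgue"
  shows "(\<lambda>x. a + t *\<^sub>R x) -` \<Omega> \<in> sets lebesgue"
  using measurable_sets[OF affine_scaleR_measurable_lebesgue[OF assms(1), of a] assms(2)] by simp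

text \<open>Domains are transported as preimages because the indicator of a preimage is the
  indicator composed with the map; this reduces the claim to the whole space.\<close>

lemma lebesgue_on_integral_affine:
  fixes f :: "'a::euclidean_space \<Rightarrow> 'b::{banach,second_countable_topology}"
  assumes "t \<noteq> 0" "\<Omega> \<in> sets lebesgue"
  shows "(\<integral>x. f (a + t *\<^sub>R x) \<partial>lebesgue_on ((\<lambda>x. a + t *\<^sub>R x) -` \<Omega>))
           = (\<integral>x. f x \<partial>lebesgue_on \<Omega>) /\<^sub>R \<bar>t\<bar> ^ DIM('a)"
proof -
  have "indicator ((\<lambda>x. a + t *\<^sub>R x) -` \<Omega>) x = (indicator \<Omega> (a + t *\<^sub>R x) :: real)" for x
    by (auto simp: indicator_def)
  then show ?thesis
    using lebesgue_integral_affine[OF assms(1), of "\<lambda>x. indicator \<Omega> x *\<^sub>R f x" a]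
      vimage_affine_sets_lebesgue[OF assms, of a] assms
    by (simp add: integral_restrict_space)
qed

lemma lebesgue_on_integrable_affine:
  fixes f :: "'a::euclidean_space \<Rightarrow> 'b::{banach,second_countable_topology}"
  assumes "t \<noteq> 0" "\<Omega> \<in> sets lebesgue"
  shows "integrable (lebesgue_on ((\<lambda>x. a + t *\<^sub>R x) -` \<Omega>)) (\<lambda>x. f (a + t *\<^sub>R x))
           \<longleftrightarrow> integrable (lebesgue_on \<Omega>) f"
proof -
  have "indicator ((\<lambda>x. a + t *\<^sub>R x) -` \<Omega>) x = (indicator \<Omega> (a + t *\<^sub>R x) :: real)" for x
    by (auto simp: indicator_def)
  then show ?thesis
    using lebesgue_integrable_affine_iff[OF assms(1), of "\<lambda>x. indicator \<Omega> x *\<^sub>R f x" a]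
      vimage_affine_sets_lebesgue[OF assms, of a] assms
    by (simp add: integrable_restrict_space)
qed

lemma lebesgue_on_measurable_affine:
  fixes f :: "'a::euclidean_space \<Rightarrow> 'b::{banach,second_countable_topology}"
  assumes "t \<noteq> 0" "\<Omega> \<in> sets lebesgue"
  shows "(\<lambda>x. f (a + t *\<^sub>R x)) \<in> borel_measurable (lebesgue_on ((\<lambda>x. a + t *\<^sub>R x) -` \<Omega>))
           \<longleftrightarrow> f \<in> borel_measurable (lebesgue_on \<Omega>)"
proof -
  have "indicator ((\<lambda>x. a + t *\<^sub>R x) -` \<Omega>) x = (indicator \<Omega> (a + t *\<^sub>R x) :: real)" for x
    by (auto simp: indicator_def)
  then show ?thesis
    using lebesgue_measurable_affine_iff[OF assms(1), of "\<lambda>x. indicator \<Omega> x *\<^sub>R f x" a]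
      vimage_affine_sets_lebesgue[OF assms, of a] assms
    by (simp add: borel_measurable_restrict_space_iff)
qed

lemma AE_lebesgue_on_affine:
  fixes a :: "'a::euclidean_space"
  assumes "t \<noteq> 0" "\<Omega> \<in> sets lebesgue"
  assumes "AE x in lebesgue_on \<Omega>. P x"
  shows "AE x in lebesgue_on ((\<lambda>x. a + t *\<^sub>R x) -` \<Omega>). P (a + t *\<^sub>R x)"
proof -
  let ?T = "\<lambda>x. a + t *\<^sub>R x"
  note T = affine_scaleR_measurable_lebesgue[OF assms(1), of a]
  have "AE x in lebesgue. x \<in> \<Omega> \<longrightarrow> P x"
    using assms by (simp add: AE_restrict_space_iff)
  then obtain M where M: "\<And>x. x \<notin> M \<Longrightarrow> x \<in> \<Omega> \<longrightarrow> P x" "M \<in> null_sets lebesgue"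
    by (auto elim!: AE_E3) blast
  have "M \<in> null_sets (density (distr lebesgue lebesgue ?T) (\<lambda>_. ennreal (\<bar>t\<bar> ^ DIM('a))))"
    using M(2) lebesgue_affine_scaleR[OF assms(1), of a] by simp
  \<comment> \<open>The density is a positive constant, so a Lebesgue null set is also null for the
    image measure.\<close>
  then have "AE x in distr lebesgue lebesgue ?T. x \<in> M \<longrightarrow> ennreal (\<bar>t\<bar> ^ DIM('a)) = 0"
    by (subst (asm) null_sets_density_iff) auto
  then have "AE x in distr lebesgue lebesgue ?T. x \<notin> M"
    by eventually_elim
      (use assms(1) zero_less_power[of "\<bar>t\<bar>" "DIM('a)"] in \<open>auto simp: ennreal_eq_0_iff simp flip: not_less\<close>)
  then have "AE x in lebesgue. ?T x \<notin> M"
    by (rule AE_distrD[OF T])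
  then have "AE x in lebesgue. ?T x \<in> \<Omega> \<longrightarrow> P (?T x)"
    by eventually_elim (use M(1) in auto)
  then show ?thesis
    using vimage_affine_sets_lebesgue[OF assms(1,2), of a] by (simp add: AE_restrict_space_iff)
qed


subsection \<open>Test functions and weak gradients\<close>

lemma frechet_derivative_affine:
  fixes f :: "'a::euclidean_space \<Rightarrow> real"
  assumes "f differentiable (at (a + t *\<^sub>R x))"
  shows "(\<lambda>x. c * f (a + t *\<^sub>R x)) differentiable (at x)"
    and "frechet_derivative (\<lambda>x. c * f (a + t *\<^sub>R x)) (at x) b
           = c * t * frechet_derivative f (at (a + t *\<^sub>R x)) b"
proof -
  define D where "D = frechet_derivative f (at (a + t *\<^sub>R x))"
  have D: "(f has_derivative D) (at (a + t *\<^sub>R x))"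
    using assms unfolding D_def by (rule frechet_derivative_works[THEN iffD1])
  have "((\<lambda>x. a + t *\<^sub>R x) has_derivative (\<lambda>h. t *\<^sub>R h)) (at x)"
    by (auto intro!: derivative_eq_intros)
  from has_derivative_compose[OF this D]
  have *: "((\<lambda>x. c * f (a + t *\<^sub>R x)) has_derivative (\<lambda>h. c * D (t *\<^sub>R h))) (at x)"
    by (rule has_derivative_mult_right)
  then show "(\<lambda>x. c * f (a + t *\<^sub>R x)) differentiable (at x)"
    by (rule differentiableI)
  have "linear D" using D by (rule has_derivative_linear)
  then show "frechet_derivative (\<lambda>x. c * f (a + t *\<^sub>R x)) (at x) b
           = c * t * frechet_derivative f (at (a + t *\<^sub>R x)) b"
    using frechet_derivative_at[OF *, symmetric] by (simp add: D_def linear_cmul)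
qed

text \<open>Each differentiation produces a factor t; the free constant c absorbs it, so that the
  induction closes.\<close>

lemma Ck_affine: "Ck k f \<Longrightarrow> Ck k (\<lambda>x. c * f (a + t *\<^sub>R x))"
proof (induction k arbitrary: f c)
  case 0
  then have "continuous_on UNIV f" by simp
  then have "continuous_on UNIV (\<lambda>x. f (a + t *\<^sub>R x))"
    by (rule continuous_on_compose2) (auto intro!: continuous_intros)
  then show ?case by (auto intro!: continuous_intros)
next
  case (Suc k)
  then have "Ck k (\<lambda>x. (c * t) * frechet_derivative f (at (a + t *\<^sub>R x)) b)" if "b \<in> Basis" for b
    using that by (intro Suc.IH) simp
  with Suc.prems show ?case
    using frechet_derivative_affine[of f a t _ c] by simp
qed

lemma test_functions_affine:
  fixes a :: "'a::euclidean_space"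
  assumes "\<phi> \<in> test_functions \<Omega>" "t \<noteq> 0"
  shows "(\<lambda>x. \<phi> (a + t *\<^sub>R x)) \<in> test_functions ((\<lambda>x. a + t *\<^sub>R x) -` \<Omega>)"
proof -
  let ?T = "\<lambda>x. a + t *\<^sub>R x" and ?S = "closure {x. \<phi> x \<noteq> 0}"
  have "?T -` ?S = (\<lambda>x. (- (a /\<^sub>R t)) + (1 / t) *\<^sub>R x) ` ?S"
    using affine_scaleR_inverse[OF assms(2), of a] by (auto simp only: vimage_eq image_iff set_eq_iff) metis+
  moreover have "compact ?S"
    using assms by (simp add: test_functions_def)
  ultimately have comp: "compact (?T -` ?S)"
    by (simp only:) (auto intro!: compact_continuous_image continuous_intros)
  have sub: "closure {x. \<phi> (?T x) \<noteq> 0} \<subseteq> ?T -` ?S"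
    using closure_subset[of "{x. \<phi> x \<noteq> 0}"] compact_imp_closed[OF comp]
    by (intro closure_minimal) auto
  have "compact (closure {x. \<phi> (?T x) \<noteq> 0})"
    using compact_Int_closed[OF comp closed_closure, of "{x. \<phi> (?T x) \<noteq> 0}"] sub
    by (simp add: Int_absorb1)
  moreover have "Ck k (\<lambda>x. \<phi> (?T x))" for k
    using Ck_affine[of k \<phi> 1 a t] assms by (simp add: test_functions_def)
  ultimately show ?thesis
    using sub assms(1) by (auto simp: test_functions_def)
qed

lemma test_functions_mono: "\<Omega> \<subseteq> \<Omega>' \<Longrightarrow> test_functions \<Omega> \<subseteq> test_functions \<Omega>'"
  by (auto simp: test_functions_def)

lemma frechet_derivative_outside_closed:
  assumes "closed S" "\<And>x. x \<notin> S \<Longrightarrow> f x = 0" "x \<notin> S"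
  shows "frechet_derivative f (at x) b = 0"
proof -
  have "((\<lambda>_. 0) has_derivative (\<lambda>_. 0)) (at x)" by simp
  then have "(f has_derivative (\<lambda>_. 0)) (at x)"
    by (rule has_derivative_transform_within_open[where s="- S"]) (use assms in auto)
  from frechet_derivative_at[OF this] show ?thesis by (metis)
qed

section \<open>Integration of functions with compact support\<close>

lemma integrable_compact_support:
  fixes f :: "'a::euclidean_space \<Rightarrow> real"
  assumes "continuous_on UNIV f" "compact S" "\<And>x. x \<notin> S \<Longrightarrow> f x = 0"
  shows "integrable lebesgue f"
proof -
  have "integrable lborel (\<lambda>x. indicator S x *\<^sub>R f x)"
    by (rule borel_integrable_compact) (use assms continuous_on_subset in blast)+
  moreover have "(\<lambda>x. indicator S x *\<^sub>R f x) = f"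
    using assms(3) by (auto simp: indicator_def fun_eq_iff)
  ultimately have "integrable lborel f" by simp
  then show ?thesis
    using integrable_completion borel_measurable_integrable by blast
qed

lemma compact_support_bounded:
  fixes f :: "'a::euclidean_space \<Rightarrow> real"
  assumes "continuous_on UNIV f" "compact S" "\<And>x. x \<notin> S \<Longrightarrow> f x = 0"
  obtains M where "0 \<le> M" "\<And>x. \<bar>f x\<bar> \<le> M"
proof -
  have "compact (f ` S)"
    using assms continuous_on_subset by (intro compact_continuous_image) blast+
  then obtain M where "\<forall>x\<in>S. \<bar>f x\<bar> \<le> M"
    by (auto simp: bounded_iff dest!: compact_imp_bounded)
  then have "\<bar>f x\<bar> \<le> max M 0" for x
    using assms(3)[of x] by (cases "x \<in> S") (auto simp: le_max_iff_disj)
  then show ?thesis using that[of "max M 0"] by auto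
qed

text \<open>The integral of a difference quotient vanishes by translation invariance.\<close>

lemma integral_directional_derivative_compact_support:
  fixes f :: "'a::euclidean_space \<Rightarrow> real"
  assumes diff: "\<And>x. f differentiable (at x)"
    and cont: "continuous_on UNIV (\<lambda>x. frechet_derivative f (at x) b)"
    and S: "compact S" "\<And>x. x \<notin> S \<Longrightarrow> f x = 0"
  shows "(\<integral>x. frechet_derivative f (at x) b \<partial>lebesgue) = 0"
proof -
  define D where "D = (\<lambda>x. frechet_derivative f (at x) b)"
  have fcont: "continuous_on UNIV f"
    using diff by (auto intro!: continuous_at_imp_continuous_on differentiable_imp_continuous_within)
  have D0: "D x = 0" if "x \<notin> S" for x
    unfolding D_def using frechet_derivative_outside_closed[OF compact_imp_closed[OF S(1)] S(2) that] .
  obtain M where M: "0 \<le> M" "\<And>x. \<bar>D x\<bar> \<le> M"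
    using compact_support_bounded[OF cont S(1)] D0 unfolding D_def by blast
  obtain R where R: "\<And>x. x \<in> S \<Longrightarrow> norm x \<le> R"
    using compact_imp_bounded[OF S(1)] by (auto simp: bounded_iff)
  have line: "((\<lambda>u. f (x + u *\<^sub>R b)) has_real_derivative D (x + u *\<^sub>R b)) (at u)" for x u
  proof -
    have "((\<lambda>u. x + u *\<^sub>R b) has_derivative (\<lambda>h. h *\<^sub>R b)) (at u)"
      by (auto intro!: derivative_eq_intros)
    moreover have fd: "(f has_derivative frechet_derivative f (at (x + u *\<^sub>R b))) (at (x + u *\<^sub>R b))"
      using diff by (rule frechet_derivative_works[THEN iffD1])
    ultimately have "((\<lambda>u. f (x + u *\<^sub>R b)) has_derivative
        (\<lambda>h. frechet_derivative f (at (x + u *\<^sub>R b)) (h *\<^sub>R b))) (at u)"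
      by (rule has_derivative_compose)
    then show ?thesis
      using has_derivative_linear[OF fd]
      by (simp add: has_field_derivative_def D_def linear_cmul mult_commute_abs)
  qed
  define h where "h = (\<lambda>n. inverse (real (Suc n)))"
  have h: "0 < h n" "h n \<le> 1" for n by (auto simp: h_def field_simps)
  have h0: "h \<longlonglongrightarrow> 0" unfolding h_def by (rule LIMSEQ_inverse_real_of_nat)
  define s where "s = (\<lambda>n x. (f (x + h n *\<^sub>R b) - f x) / h n)"
  have fint: "integrable lebesgue f"
    by (rule integrable_compact_support[OF fcont S])
  have "(\<lambda>n. integral\<^sup>L lebesgue (s n)) \<longlonglongrightarrow> integral\<^sup>L lebesgue D"
  proof (rule integral_dominated_convergence)
    show "D \<in> borel_measurable lebesgue"
      using integrable_compact_support[OF cont S(1)] D0 unfolding D_def by blast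
    show "s n \<in> borel_measurable lebesgue" for n
    proof -
      have "continuous_on UNIV (\<lambda>x. f (x + h n *\<^sub>R b))"
        by (rule continuous_on_compose2[OF fcont]) (auto intro!: continuous_intros)
      then have "continuous_on UNIV (s n)"
        using fcont h(1)[of n] unfolding s_def by (intro continuous_on_divide continuous_on_diff continuous_on_const) auto
      then show ?thesis
        by (intro measurable_completion) (simp add: borel_measurable_continuous_onI)
    qed
    \<comment> \<open>The increments \<open>h n\<close> are at most 1, so all difference quotients
      vanish off the ball of radius R + norm b; on it the mean value theorem bounds them by
      M.\<close>
    show "integrable lebesgue (\<lambda>x. M * indicator (cball 0 (R + norm b)) x)"
      using emeasure_bounded_finite[OF bounded_cball, of 0 "R + norm b"]
      by (intro integrable_mult_right integrable_real_indicator) (auto simp: less_top[symmetric])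
    show "AE x in lebesgue. (\<lambda>n. s n x) \<longlonglongrightarrow> D x"
    proof (rule AE_I2)
      fix x
      have "((\<lambda>u. (f (x + u *\<^sub>R b) - f x) / u) \<longlongrightarrow> D x) (at 0)"
        using line[of x 0] by (simp add: has_field_derivative_iff)
      moreover have "filterlim h (at 0) sequentially"
        using h0 h(1) by (auto simp: filterlim_at intro!: always_eventually less_imp_neq[THEN not_sym])
      ultimately show "(\<lambda>n. s n x) \<longlonglongrightarrow> D x"
        unfolding s_def by (rule filterlim_compose)
    qed
    show "AE x in lebesgue. norm (s n x) \<le> M * indicator (cball 0 (R + norm b)) x" for n
    proof (rule AE_I2)
      fix x
      show "norm (s n x) \<le> M * indicator (cball 0 (R + norm b)) x"
      proof (cases "x \<in> cball 0 (R + norm b)")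
        case True
        obtain z where "0 < z" "z < h n" "f (x + h n *\<^sub>R b) - f (x + 0 *\<^sub>R b) = (h n - 0) * D (x + z *\<^sub>R b)"
          using MVT2[OF h(1)[of n], of "\<lambda>u. f (x + u *\<^sub>R b)" "\<lambda>u. D (x + u *\<^sub>R b)"] line by blast
        then have "s n x = D (x + z *\<^sub>R b)"
          using h(1)[of n] by (simp add: s_def)
        then show ?thesis using M True by simp
      next
        case False
        then have x: "R + norm b < norm x" by simp
        have "norm x \<le> norm (x + h n *\<^sub>R b) + norm (h n *\<^sub>R b)"
          by (metis add.commute norm_triangle_sub add_diff_cancel_left' norm_minus_commute)
        moreover have "norm (h n *\<^sub>R b) \<le> norm b"
          using h[of n] mult_right_mono[of "h n" 1 "norm b"] by simp
        ultimately have "x + h n *\<^sub>R b \<notin> S" "x \<notin> S"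
          using R[of x] R[of "x + h n *\<^sub>R b"] x norm_ge_zero[of b] by linarith+
        then have "s n x = 0" using S(2)[of x] S(2)[of "x + h n *\<^sub>R b"] by (simp add: s_def)
        then show ?thesis using False by simp
      qed
    qed
  qed
  moreover have "integral\<^sup>L lebesgue (s n) = 0" for n
  proof -
    have "integrable lebesgue (\<lambda>x. f (h n *\<^sub>R b + 1 *\<^sub>R x))"
      using lebesgue_integrable_affine_iff[of 1 f "h n *\<^sub>R b"] fint by simp
    moreover have "(\<integral>x. f (h n *\<^sub>R b + 1 *\<^sub>R x) \<partial>lebesgue) = (\<integral>x. f x \<partial>lebesgue)"
      using lebesgue_integral_affine[of 1 f "h n *\<^sub>R b"] by simp
    ultimately show ?thesis
      using fint by (simp add: s_def add.commute)
  qed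
  ultimately have "(\<lambda>n. 0) \<longlonglongrightarrow> integral\<^sup>L lebesgue D" by simp
  then show ?thesis
    using LIMSEQ_unique tendsto_const unfolding D_def by blast
qed

lemma test_functionsD:
  assumes "\<phi> \<in> test_functions \<Omega>"
  shows "\<phi> differentiable (at x)" "continuous_on UNIV \<phi>"
    and "b \<in> Basis \<Longrightarrow> continuous_on UNIV (\<lambda>x. frechet_derivative \<phi> (at x) b)"
    and "compact (closure {x. \<phi> x \<noteq> 0})" "closure {x. \<phi> x \<noteq> 0} \<subseteq> \<Omega>"
    and "x \<notin> closure {x. \<phi> x \<noteq> 0} \<Longrightarrow> \<phi> x = 0"
    and "x \<notin> closure {x. \<phi> x \<noteq> 0} \<Longrightarrow> frechet_derivative \<phi> (at x) b = 0"
proof -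
  have Ck: "Ck 0 \<phi>" "Ck (Suc 0) \<phi>"
    using assms unfolding test_functions_def by blast+
  then show "\<phi> differentiable (at x)" "continuous_on UNIV \<phi>"
    and "b \<in> Basis \<Longrightarrow> continuous_on UNIV (\<lambda>x. frechet_derivative \<phi> (at x) b)"
    by auto
  show "compact (closure {x. \<phi> x \<noteq> 0})" "closure {x. \<phi> x \<noteq> 0} \<subseteq> \<Omega>"
    using assms by (auto simp: test_functions_def)
  show *: "x \<notin> closure {x. \<phi> x \<noteq> 0} \<Longrightarrow> \<phi> x = 0" for x
    using closure_subset[of "{x. \<phi> x \<noteq> 0}"] by auto
  show "x \<notin> closure {x. \<phi> x \<noteq> 0} \<Longrightarrow> frechet_derivative \<phi> (at x) b = 0"
    by (rule frechet_derivative_outside_closed[OF closed_closure *])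
qed

lemma integral_lebesgue_on_support:
  fixes f :: "'a::euclidean_space \<Rightarrow> 'b::{banach,second_countable_topology}"
  assumes "\<Omega> \<in> sets lebesgue" "\<And>x. x \<notin> \<Omega> \<Longrightarrow> f x = 0"
  shows "(\<integral>x. f x \<partial>lebesgue_on \<Omega>) = (\<integral>x. f x \<partial>lebesgue)"
  using assms by (simp add: integral_restrict_space)
    (auto intro!: Bochner_Integration.integral_cong simp: indicator_def)

text \<open>The affine function times a test function has compact support, so its partial
  derivatives integrate to 0; the product rule turns this into integration by parts.\<close>

lemma has_weak_gradient_linear:
  fixes e :: "'a::euclidean_space"
  assumes "open \<Omega>"
  shows "has_weak_gradient \<Omega> (\<lambda>x. x \<bullet> e - c) (\<lambda>_. e)"
  unfolding has_weak_gradient_def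
proof safe
  fix \<phi> :: "'a \<Rightarrow> real" and b :: 'a
  assume \<phi>: "\<phi> \<in> test_functions \<Omega>" and b: "b \<in> Basis"
  note T = test_functionsD[OF \<phi>]
  have \<Omega>: "\<Omega> \<in> sets lebesgue" using assms by auto
  have zero: "\<phi> x = 0" "frechet_derivative \<phi> (at x) b = 0" if "x \<notin> \<Omega>" for x
    using T(6,7)[of x] that T(5) by auto
  let ?f = "\<lambda>x. (x \<bullet> e - c) * \<phi> x"
  have der: "(?f has_derivative (\<lambda>h. (x \<bullet> e - c) * frechet_derivative \<phi> (at x) h + (h \<bullet> e) * \<phi> x)) (at x)" for x
    using frechet_derivative_works[THEN iffD1, OF T(1), of x]
    by (auto intro!: derivative_eq_intros)
  have f': "frechet_derivative ?f (at x) b = (x \<bullet> e - c) * frechet_derivative \<phi> (at x) b + (e \<bullet> b) * \<phi> x" for x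
    using frechet_derivative_at[OF der, of x] by (simp add: inner_commute fun_eq_iff)
  have "(\<integral>x. frechet_derivative ?f (at x) b \<partial>lebesgue) = 0"
  proof (rule integral_directional_derivative_compact_support[OF _ _ T(4)])
    show "?f differentiable (at x)" for x using der by (rule differentiableI)
    show "continuous_on UNIV (\<lambda>x. frechet_derivative ?f (at x) b)"
      unfolding f' by (intro continuous_intros T(2) T(3)[OF b])
    show "?f x = 0" if "x \<notin> closure {x. \<phi> x \<noteq> 0}" for x
      using T(6)[OF that] by simp
  qed
  moreover have "integrable lebesgue (\<lambda>x. (x \<bullet> e - c) * frechet_derivative \<phi> (at x) b)"
  proof (rule integrable_compact_support[OF _ T(4)])
    show "continuous_on UNIV (\<lambda>x. (x \<bullet> e - c) * frechet_derivative \<phi> (at x) b)"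
      by (rule continuous_on_mult[OF _ T(3)[OF b]]) (auto intro!: continuous_intros)
    show "(x \<bullet> e - c) * frechet_derivative \<phi> (at x) b = 0" if "x \<notin> closure {x. \<phi> x \<noteq> 0}" for x
      using T(7)[OF that, of b] by simp
  qed
  moreover have "integrable lebesgue (\<lambda>x. (e \<bullet> b) * \<phi> x)"
  proof (rule integrable_compact_support[OF _ T(4)])
    show "continuous_on UNIV (\<lambda>x. (e \<bullet> b) * \<phi> x)"
      by (rule continuous_on_mult[OF continuous_on_const T(2)])
    show "(e \<bullet> b) * \<phi> x = 0" if "x \<notin> closure {x. \<phi> x \<noteq> 0}" for x
      using T(6)[OF that] by simp
  qed
  ultimately have "(\<integral>x. (x \<bullet> e - c) * frechet_derivative \<phi> (at x) b \<partial>lebesgue)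
      = - (\<integral>x. (e \<bullet> b) * \<phi> x \<partial>lebesgue)"
    unfolding f' by simp
  moreover have "(\<integral>x. (x \<bullet> e - c) * frechet_derivative \<phi> (at x) b \<partial>lebesgue_on \<Omega>)
      = (\<integral>x. (x \<bullet> e - c) * frechet_derivative \<phi> (at x) b \<partial>lebesgue)"
    by (rule integral_lebesgue_on_support[OF \<Omega>]) (simp add: zero)
  moreover have "(\<integral>x. (e \<bullet> b) * \<phi> x \<partial>lebesgue_on \<Omega>) = (\<integral>x. (e \<bullet> b) * \<phi> x \<partial>lebesgue)"
    by (rule integral_lebesgue_on_support[OF \<Omega>]) (simp add: zero)
  ultimately show "(\<integral>x. (x \<bullet> e - c) * frechet_derivative \<phi> (at x) b \<partial>lebesgue_on \<Omega>)
      = - (\<integral>x. (e \<bullet> b) * \<phi> x \<partial>lebesgue_on \<Omega>)"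
    by argo
qed

lemma has_weak_gradient_diff_const:
  fixes v :: "'a::euclidean_space \<Rightarrow> real"
  assumes "open \<Omega>" "integrable (lebesgue_on \<Omega>) v" "has_weak_gradient \<Omega> v g"
  shows "has_weak_gradient \<Omega> (\<lambda>x. v x - c) g"
  unfolding has_weak_gradient_def
proof safe
  fix \<phi> :: "'a \<Rightarrow> real" and b :: 'a
  assume \<phi>: "\<phi> \<in> test_functions \<Omega>" and b: "b \<in> Basis"
  note T = test_functionsD[OF \<phi>]
  have \<Omega>: "\<Omega> \<in> sets lebesgue" using assms by auto
  let ?D = "\<lambda>x. frechet_derivative \<phi> (at x) b"
  obtain M where M: "0 \<le> M" "\<And>x. \<bar>?D x\<bar> \<le> M"
    using compact_support_bounded[OF T(3)[OF b] T(4,7)] by blast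
  have Dint: "integrable lebesgue ?D"
    by (rule integrable_compact_support[OF T(3)[OF b] T(4,7)])
  then have Dint': "integrable (lebesgue_on \<Omega>) ?D"
    using \<Omega> by (simp add: integrable_restrict_space integrable_mult_indicator del: real_scaleR_def)
  \<comment> \<open>Needed to split the integral of (v - c) D: v is integrable and D is
    bounded.\<close>
  have "integrable (lebesgue_on \<Omega>) (\<lambda>x. v x * ?D x)"
  proof (rule Bochner_Integration.integrable_bound)
    show "integrable (lebesgue_on \<Omega>) (\<lambda>x. M * v x)" using assms by simp
    show "(\<lambda>x. v x * ?D x) \<in> borel_measurable (lebesgue_on \<Omega>)"
      using assms(2) Dint' by (intro borel_measurable_times borel_measurable_integrable)
    show "AE x in lebesgue_on \<Omega>. norm (v x * ?D x) \<le> norm (M * v x)"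
      using M by (auto simp: abs_mult mult.commute[of M] intro!: mult_left_mono AE_I2)
  qed
  \<comment> \<open>For e = 0 and c = -1 the affine function is the constant 1, with gradient
    0.\<close>
  moreover have "(\<integral>x. ?D x \<partial>lebesgue_on \<Omega>) = 0"
    using has_weak_gradient_linear[OF assms(1), of 0 "-1"] \<phi> b
    by (auto simp: has_weak_gradient_def)
  ultimately show "(\<integral>x. (v x - c) * ?D x \<partial>lebesgue_on \<Omega>) = - (\<integral>x. (g x \<bullet> b) * \<phi> x \<partial>lebesgue_on \<Omega>)"
    using Dint' assms(3) \<phi> b by (simp add: left_diff_distrib has_weak_gradient_def)
qed

text \<open>A test function on the smaller set is one on the larger set, and the integrals over both
  sets only see its support.\<close>

lemma has_weak_gradient_subset:
  fixes v :: "'a::euclidean_space \<Rightarrow> real"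
  assumes "open \<Omega>" "open \<Omega>'" "\<Omega>' \<subseteq> \<Omega>" "has_weak_gradient \<Omega> v g"
  shows "has_weak_gradient \<Omega>' v g"
  unfolding has_weak_gradient_def
proof safe
  fix \<phi> :: "'a \<Rightarrow> real" and b :: 'a
  assume \<phi>: "\<phi> \<in> test_functions \<Omega>'" and b: "b \<in> Basis"
  note T = test_functionsD[OF \<phi>]
  have \<Omega>: "\<Omega> \<in> sets lebesgue" "\<Omega>' \<in> sets lebesgue" using assms by auto
  have "\<phi> \<in> test_functions \<Omega>" using \<phi> assms test_functions_mono by blast
  then have "(\<integral>x. v x * frechet_derivative \<phi> (at x) b \<partial>lebesgue_on \<Omega>) = - (\<integral>x. (g x \<bullet> b) * \<phi> x \<partial>lebesgue_on \<Omega>)"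
    using assms(4) b by (auto simp: has_weak_gradient_def)
  moreover have "(\<integral>x. v x * frechet_derivative \<phi> (at x) b \<partial>lebesgue_on A) = (\<integral>x. v x * frechet_derivative \<phi> (at x) b \<partial>lebesgue)"
    "(\<integral>x. (g x \<bullet> b) * \<phi> x \<partial>lebesgue_on A) = (\<integral>x. (g x \<bullet> b) * \<phi> x \<partial>lebesgue)" if "A \<in> sets lebesgue" "\<Omega>' \<subseteq> A" for A
  proof -
    have "\<phi> x = 0" "frechet_derivative \<phi> (at x) b = 0" if "x \<notin> A" for x
      using T(6,7)[of x] that T(5) \<open>\<Omega>' \<subseteq> A\<close> by auto
    then show "(\<integral>x. v x * frechet_derivative \<phi> (at x) b \<partial>lebesgue_on A) = (\<integral>x. v x * frechet_derivative \<phi> (at x) b \<partial>lebesgue)"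
      "(\<integral>x. (g x \<bullet> b) * \<phi> x \<partial>lebesgue_on A) = (\<integral>x. (g x \<bullet> b) * \<phi> x \<partial>lebesgue)"
      using that(1) by (intro integral_lebesgue_on_support; simp)+
  qed
  ultimately show "(\<integral>x. v x * frechet_derivative \<phi> (at x) b \<partial>lebesgue_on \<Omega>') = - (\<integral>x. (g x \<bullet> b) * \<phi> x \<partial>lebesgue_on \<Omega>')"
    using \<Omega> assms(3) by simp
qed

lemma has_weak_gradient_affine:
  fixes v :: "'a::euclidean_space \<Rightarrow> real"
  assumes "open \<Omega>" "t > 0" "has_weak_gradient \<Omega> v g"
  shows "has_weak_gradient ((\<lambda>x. a + t *\<^sub>R x) -` \<Omega>) (\<lambda>x. v (a + t *\<^sub>R x)) (\<lambda>x. t *\<^sub>R g (a + t *\<^sub>R x))"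
  unfolding has_weak_gradient_def
proof safe
  let ?T = "\<lambda>x. a + t *\<^sub>R x"
  fix \<phi> :: "'a \<Rightarrow> real" and b :: 'a
  assume \<phi>: "\<phi> \<in> test_functions (?T -` \<Omega>)" and b: "b \<in> Basis"
  have t: "t \<noteq> 0" using assms(2) by simp
  have \<Omega>: "\<Omega> \<in> sets lebesgue" using assms by auto
  define a' where "a' = - (a /\<^sub>R t)"
  have inv: "a + t *\<^sub>R (a' + (1 / t) *\<^sub>R x) = x" "a' + (1 / t) *\<^sub>R (a + t *\<^sub>R x) = x" for x
    unfolding a'_def by (rule affine_scaleR_inverse[OF t])+
  \<comment> \<open>The test function is pulled back by the inverse map. Its derivative carries a
    factor 1/t, which reappears as the factor t in the transported gradient.\<close>
  define \<psi> where "\<psi> = (\<lambda>x. \<phi> (a' + (1 / t) *\<^sub>R x))"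
  have "(\<lambda>x. a' + (1 / t) *\<^sub>R x) -` (?T -` \<Omega>) = \<Omega>"
    by (simp only: inv vimage_def mem_Collect_eq Collect_mem_eq)
  then have \<psi>: "\<psi> \<in> test_functions \<Omega>"
    using test_functions_affine[OF \<phi>, of "1/t" a'] t by (simp add: \<psi>_def)
  have \<psi>T: "\<psi> (?T x) = \<phi> x" for x
    unfolding \<psi>_def inv ..
  have \<psi>': "frechet_derivative \<psi> (at (?T x)) b = frechet_derivative \<phi> (at x) b / t" for x
    using frechet_derivative_affine(2)[of \<phi> a' "1/t" "?T x" 1 b] test_functionsD(1)[OF \<phi>]
    unfolding \<psi>_def inv by simp
  have "(\<integral>x. v x * frechet_derivative \<psi> (at x) b \<partial>lebesgue_on \<Omega>) = - (\<integral>x. (g x \<bullet> b) * \<psi> x \<partial>lebesgue_on \<Omega>)"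
    using assms(3) b \<psi> by (auto simp: has_weak_gradient_def)
  then have "(\<integral>x. v (?T x) * (frechet_derivative \<phi> (at x) b / t) \<partial>lebesgue_on (?T -` \<Omega>))
      = - (\<integral>x. (g (?T x) \<bullet> b) * \<phi> x \<partial>lebesgue_on (?T -` \<Omega>))"
    using lebesgue_on_integral_affine[OF t \<Omega>, where a=a and f="\<lambda>x. v x * frechet_derivative \<psi> (at x) b"]
      lebesgue_on_integral_affine[OF t \<Omega>, where a=a and f="\<lambda>x. (g x \<bullet> b) * \<psi> x"]
    by (simp add: \<psi>' \<psi>T)
  then show "(\<integral>x. v (?T x) * frechet_derivative \<phi> (at x) b \<partial>lebesgue_on (?T -` \<Omega>))
      = - (\<integral>x. (t *\<^sub>R g (?T x) \<bullet> b) * \<phi> x \<partial>lebesgue_on (?T -` \<Omega>))"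
    using assms(2) by (simp add: field_simps)
qed


subsection \<open>Centring by constants\<close>

text \<open>The derivative of |u|^q / q. The constraint in \<open>mu\<close> is thus the
  stationarity of the integral of |v - c|^q at c = 0.\<close>

definition signed_power :: "real \<Rightarrow> real \<Rightarrow> real" where
  "signed_power q u = \<bar>u\<bar> powr (q - 2) * u"

text \<open>For 1 < q < 2 the definition contains a negative power of |u|. Here only the positive
  exponent q - 1 occurs, which makes monotonicity and continuity visible also at 0.\<close>

lemma signed_power_eq_diff:
  "signed_power q u = max u 0 powr (q - 1) - max (- u) 0 powr (q - 1)"
proof -
  have "\<bar>u\<bar> powr (q - 2) * \<bar>u\<bar> = \<bar>u\<bar> powr (q - 1)"
    using powr_mult_base[of "\<bar>u\<bar>" "q - 2"] by (simp add: algebra_simps)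
  then show ?thesis
    by (cases u "0::real" rule: linorder_cases) (auto simp: signed_power_def)
qed

lemma abs_signed_power: "\<bar>signed_power q u\<bar> = \<bar>u\<bar> powr (q - 1)"
  by (cases u "0::real" rule: linorder_cases) (auto simp: signed_power_eq_diff)

lemma signed_power_times_self: "signed_power q u * u = \<bar>u\<bar> powr q"
proof -
  have "signed_power q u * u = \<bar>u\<bar> * \<bar>u\<bar> powr (q - 1)"
    by (cases u "0::real" rule: linorder_cases) (auto simp: signed_power_eq_diff)
  then show ?thesis
    using powr_mult_base[of "\<bar>u\<bar>" "q - 1"] by simp
qed

lemma signed_power_minus: "signed_power q (- u) = - signed_power q u"
  by (simp add: signed_power_def)

lemma signed_power_mono:
  assumes "1 < q" "u \<le> v" shows "signed_power q u \<le> signed_power q v"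
  unfolding signed_power_eq_diff using assms by (intro diff_mono powr_mono2) auto

lemma continuous_on_signed_power:
  assumes "1 < q" shows "continuous_on A (signed_power q)"
  unfolding signed_power_eq_diff[abs_def]
  using assms by (intro continuous_intros continuous_on_powr') auto

lemma borel_measurable_signed_power [measurable]: "signed_power q \<in> borel_measurable borel"
  unfolding signed_power_def[abs_def] by measurable

lemma norm_add_powr_le:
  fixes a b :: "'a::real_normed_vector"
  assumes "0 \<le> r"
  shows "norm (a + b) powr r \<le> 2 powr r * (norm a powr r + norm b powr r)"
proof -
  have "norm (a + b) powr r \<le> (2 * max (norm a) (norm b)) powr r"
    using assms norm_triangle_ineq[of a b] by (intro powr_mono2) auto
  also have "\<dots> = 2 powr r * max (norm a) (norm b) powr r"
    by (rule powr_mult)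
  also have "\<dots> \<le> 2 powr r * (norm a powr r + norm b powr r)"
    by (intro mult_left_mono) (auto simp: max_def)
  finally show ?thesis .
qed

text \<open>The convex function |u - c|^q of c lies above its tangent at c = 0. Young's inequality
  with exponents q and q / (q - 1), applied to |u - c| and |u|^(q - 1), gives this without
  differentiation.\<close>

lemma abs_diff_powr_ge_tangent:
  fixes u c q :: real
  assumes "1 < q"
  shows "\<bar>u\<bar> powr q - q * c * signed_power q u \<le> \<bar>u - c\<bar> powr q"
proof -
  let ?w = "u - c"
  have "?w * signed_power q u \<le> \<bar>?w\<bar> * \<bar>u\<bar> powr (q - 1)"
    using abs_ge_self[of "?w * signed_power q u"] by (simp add: abs_mult abs_signed_power)
  also have "\<dots> \<le> \<bar>?w\<bar> powr q / q + (\<bar>u\<bar> powr (q - 1)) powr (q / (q - 1)) / (q / (q - 1))"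
    using assms by (intro Youngs_inequality) (auto simp: field_simps)
  also have "(\<bar>u\<bar> powr (q - 1)) powr (q / (q - 1)) = \<bar>u\<bar> powr q"
    using assms by (simp add: powr_powr)
  finally have "q * (?w * signed_power q u) \<le> \<bar>?w\<bar> powr q + (q - 1) * \<bar>u\<bar> powr q"
    using assms by (simp add: field_simps)
  moreover have "?w * signed_power q u = \<bar>u\<bar> powr q - c * signed_power q u"
    using signed_power_times_self[of q u] by (simp add: algebra_simps)
  ultimately show ?thesis by (simp add: algebra_simps)
qed

section \<open>Integrability under shifts and existence of a centring constant\<close>

lemma integrable_shift_powr:
  fixes v :: "'b \<Rightarrow> real"
  assumes "finite_measure M" "0 \<le> r" and [measurable]: "v \<in> borel_measurable M"
    and "integrable M (\<lambda>x. \<bar>v x\<bar> powr r)"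
  shows "integrable M (\<lambda>x. \<bar>v x - c\<bar> powr r)"
proof (rule Bochner_Integration.integrable_bound)
  interpret finite_measure M by fact
  show "integrable M (\<lambda>x. 2 powr r * (\<bar>v x\<bar> powr r + \<bar>- c\<bar> powr r))"
    using assms by (intro integrable_mult_right Bochner_Integration.integrable_add) auto
  show "(\<lambda>x. \<bar>v x - c\<bar> powr r) \<in> borel_measurable M" by measurable
  show "AE x in M. norm (\<bar>v x - c\<bar> powr r) \<le> norm (2 powr r * (\<bar>v x\<bar> powr r + \<bar>- c\<bar> powr r))"
    using norm_add_powr_le[OF assms(2), of "v _" "- c"] by (intro AE_I2) simp
qed

lemma integrable_signed_power_shift:
  fixes v :: "'b \<Rightarrow> real"
  assumes "finite_measure M" "1 < q" and [measurable]: "v \<in> borel_measurable M"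
    and int: "integrable M (\<lambda>x. signed_power q (v x))"
  shows "integrable M (\<lambda>x. signed_power q (v x - c))"
proof -
  have "integrable M (\<lambda>x. \<bar>v x\<bar> powr (q - 1))"
    using integrable_abs[OF int] by (simp add: abs_signed_power)
  from integrable_shift_powr[OF assms(1) _ assms(3) this, of c]
  have "integrable M (\<lambda>x. \<bar>v x - c\<bar> powr (q - 1))" using assms(2) by simp
  then show ?thesis
    by (rule Bochner_Integration.integrable_bound) (auto simp: abs_signed_power)
qed

text \<open>As the shift grows, the integrand tends to -\<infinity>. Truncated below at -1 it is
  dominated, so its integral tends to minus the mass of M, which is negative unless M is null;
  truncation only increases the integral.\<close>

lemma exists_shift_signed_power_nonpos:
  fixes v :: "'b \<Rightarrow> real"
  assumes "finite_measure M" "1 < q" and [measurable]: "v \<in> borel_measurable M"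
    and int: "integrable M (\<lambda>x. signed_power q (v x))"
  shows "\<exists>c. (\<integral>x. signed_power q (v x - c) \<partial>M) \<le> 0"
proof (cases "emeasure M (space M) = 0")
  case True
  then have "AE x in M. signed_power q (v x - 0) = 0"
    using AE_iff_null_sets[of "space M" M] by (auto simp: null_sets_def elim: AE_mp)
  then show ?thesis by (intro exI[of _ 0]) (simp add: integral_eq_zero_AE)
next
  case False
  interpret finite_measure M by fact
  define h where "h = (\<lambda>n x. max (signed_power q (v x - real n)) (- 1))"
  note vint = integrable_signed_power_shift[OF assms(1-3) int]
  have "(\<lambda>n. integral\<^sup>L M (h n)) \<longlonglongrightarrow> (\<integral>x. - 1 \<partial>M)"
  proof (rule integral_dominated_convergence)
    show "integrable M (\<lambda>x. \<bar>signed_power q (v x)\<bar> + 1)"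
      using int by auto
    show "h n \<in> borel_measurable M" for n unfolding h_def by measurable
    show "AE x in M. norm (h n x) \<le> \<bar>signed_power q (v x)\<bar> + 1" for n
    proof (rule AE_I2)
      fix x
      have "signed_power q (v x - real n) \<le> signed_power q (v x)"
        using assms(2) by (intro signed_power_mono) auto
      then show "norm (h n x) \<le> \<bar>signed_power q (v x)\<bar> + 1"
        unfolding h_def by (auto simp: max_def abs_if)
    qed
    show "AE x in M. (\<lambda>n. h n x) \<longlonglongrightarrow> - 1"
    proof (rule AE_I2)
      fix x
      obtain m :: nat where m: "v x + 1 < real m" using reals_Archimedean2 by blast
      have "h n x = - 1" if "n \<ge> m" for n
      proof -
        have "signed_power q (v x - real n) \<le> signed_power q (- 1)"
          using assms(2) m that by (intro signed_power_mono) auto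
        also have "signed_power q (- 1) = - 1" by (simp add: signed_power_def)
        finally show ?thesis unfolding h_def by simp
      qed
      then show "(\<lambda>n. h n x) \<longlonglongrightarrow> - 1"
        by (intro tendsto_eventually) (auto simp: eventually_sequentially)
    qed
  qed auto
  moreover have "(\<integral>x. - 1 \<partial>M) < (0::real)"
    using False by (simp add: measure_def enn2real_positive_iff less_top[symmetric] zero_less_iff_neq_zero)
  ultimately have "eventually (\<lambda>n. integral\<^sup>L M (h n) < 0) sequentially"
    by (rule order_tendstoD(2))
  then obtain n where n: "integral\<^sup>L M (h n) < 0"
    by (auto simp: eventually_sequentially)
  have "(\<integral>x. signed_power q (v x - real n) \<partial>M) \<le> integral\<^sup>L M (h n)"
  proof (rule integral_mono)
    show "integrable M (h n)" unfolding h_def by (intro integrable_max vint) simp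
  qed (auto simp: h_def vint)
  with n show ?thesis by (intro exI[of _ "real n"]) linarith
qed

text \<open>If \<open>|v| powr (q - 1)\<close> is not integrable, the shift \<open>0\<close> works, because the integral is then \<open>0\<close> by
  convention; otherwise the intermediate value theorem applies.\<close>

lemma exists_centering:
  fixes v :: "'b \<Rightarrow> real"
  assumes "finite_measure M" "1 < q" and [measurable]: "v \<in> borel_measurable M"
  shows "\<exists>c. (\<integral>x. signed_power q (v x - c) \<partial>M) = 0"
proof (cases "integrable M (\<lambda>x. signed_power q (v x))")
  case False
  then show ?thesis by (intro exI[of _ 0]) (simp add: not_integrable_integral_eq)
next
  case int: True
  interpret finite_measure M by fact
  define G where "G = (\<lambda>c. \<integral>x. signed_power q (v x - c) \<partial>M)"
  note vint = integrable_signed_power_shift[OF assms(1-3) int]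
  obtain c1 where c1: "G c1 \<le> 0"
    using exists_shift_signed_power_nonpos[OF assms int] unfolding G_def by blast
  \<comment> \<open>Since \<open>signed_power q\<close> is odd, a nonpositive integral for -v
    becomes a nonnegative one for v.\<close>
  have "integrable M (\<lambda>x. signed_power q (- v x))"
    using int by (simp add: signed_power_minus)
  from exists_shift_signed_power_nonpos[OF assms(1,2) _ this]
  obtain c2 where "(\<integral>x. signed_power q (- v x - c2) \<partial>M) \<le> 0" by auto
  moreover have "signed_power q (- v x - c2) = - signed_power q (v x - (- c2))" for x
    using signed_power_minus[of q "v x - (- c2)"] by (simp only: minus_diff_eq diff_minus_eq_add minus_add_distrib diff_conv_add_uminus add.commute minus_minus)
  ultimately have c2: "0 \<le> G (- c2)" unfolding G_def by simp
  have "continuous_on UNIV G"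
  proof (rule continuous_on_sequentiallyI)
    fix c :: "nat \<Rightarrow> real" and l
    assume c: "c \<longlonglongrightarrow> l"
    then obtain C where C: "\<And>n. \<bar>c n\<bar> \<le> C"
      using convergent_imp_bounded[OF c] by (auto simp: bounded_iff)
    show "(\<lambda>n. G (c n)) \<longlonglongrightarrow> G l"
      unfolding G_def
    proof (rule integral_dominated_convergence)
      \<comment> \<open>By monotonicity, the values at the extreme shifts C and -C enclose those at
        all \<open>c n\<close>.\<close>
      show "integrable M (\<lambda>x. \<bar>signed_power q (v x - C)\<bar> + \<bar>signed_power q (v x - (- C))\<bar>)"
        by (intro Bochner_Integration.integrable_add integrable_abs vint)
      show "AE x in M. norm (signed_power q (v x - c n)) \<le> \<bar>signed_power q (v x - C)\<bar> + \<bar>signed_power q (v x - (- C))\<bar>" for n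
      proof (rule AE_I2)
        fix x
        have "signed_power q (v x - C) \<le> signed_power q (v x - c n)"
          "signed_power q (v x - c n) \<le> signed_power q (v x - (- C))"
          using C[of n] assms(2) by (auto intro!: signed_power_mono)
        then show "norm (signed_power q (v x - c n)) \<le> \<bar>signed_power q (v x - C)\<bar> + \<bar>signed_power q (v x - (- C))\<bar>"
          by auto
      qed
      show "AE x in M. (\<lambda>n. signed_power q (v x - c n)) \<longlonglongrightarrow> signed_power q (v x - l)"
        using continuous_on_signed_power[OF assms(2), of UNIV] c
        by (intro AE_I2 isCont_tendsto_compose[of _ "signed_power q"] tendsto_intros)
          (auto simp: continuous_on_eq_continuous_at)
    qed measurable
  qed
  then have "\<exists>c. G c = 0"
    using IVT'[of G c1 0 "- c2"] IVT2'[of G c1 0 "- c2"] c1 c2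
    by (metis continuous_on_subset linear subset_UNIV)
  then show ?thesis unfolding G_def .
qed


subsection \<open>Admissible functions and the volume bound\<close>

lemma lmeasurable_open_bounded:
  fixes \<Omega> :: "'a::euclidean_space set"
  assumes "open \<Omega>" "bounded \<Omega>"
  shows "\<Omega> \<in> lmeasurable" "finite_measure (lebesgue_on \<Omega>)" "\<Omega> \<in> sets lebesgue"
  using assms by (auto simp: lmeasurable_open intro!: finite_measure_lebesgue_on)

lemma measure_vimage_affine:
  fixes a :: "'a::euclidean_space"
  assumes "t \<noteq> 0" "\<Omega> \<in> sets lebesgue"
  shows "measure lebesgue ((\<lambda>x. a + t *\<^sub>R x) -` \<Omega>) = measure lebesgue \<Omega> / \<bar>t\<bar> ^ DIM('a)"
proof -
  let ?V = "(\<lambda>x. a + t *\<^sub>R x) -` \<Omega>"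
  have "measure lebesgue ?V = (\<integral>x. indicator ?V x \<partial>lebesgue)"
    using vimage_affine_sets_lebesgue[OF assms, of a] by simp
  also have "(indicator ?V :: 'a \<Rightarrow> real) = (\<lambda>x. indicator \<Omega> (a + t *\<^sub>R x))"
    by (auto simp: indicator_def)
  also have "(\<integral>x. indicator \<Omega> (a + t *\<^sub>R x) \<partial>lebesgue) = measure lebesgue \<Omega> / \<bar>t\<bar> ^ DIM('a)"
    using lebesgue_integral_affine[OF assms(1), of "indicator \<Omega> :: 'a \<Rightarrow> real" a] assms(2)
    by (simp add: divide_inverse mult.commute)
  finally show ?thesis .
qed

definition mu_admissible :: "real \<Rightarrow> real \<Rightarrow> 'a::euclidean_space set \<Rightarrow> (('a \<Rightarrow> real) \<times> ('a \<Rightarrow> 'a)) set" where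
  "mu_admissible p q \<Omega> = {(v, g). (v, g) \<in> W1p_graph p \<Omega> \<and> \<not> (AE x in lebesgue_on \<Omega>. v x = 0) \<and>
      (\<integral>x. signed_power q (v x) \<partial>lebesgue_on \<Omega>) = 0}"

definition rayleigh :: "real \<Rightarrow> real \<Rightarrow> 'a::euclidean_space set \<Rightarrow> ('a \<Rightarrow> real) \<times> ('a \<Rightarrow> 'a) \<Rightarrow> real" where
  "rayleigh p q \<Omega> = (\<lambda>(v, g). (\<integral>x. norm (g x) powr p \<partial>lebesgue_on \<Omega>)
        / (\<integral>x. \<bar>v x\<bar> powr q \<partial>lebesgue_on \<Omega>) powr (p / q))"

lemma mu_eq_Inf: "mu p q \<Omega> = Inf (rayleigh p q \<Omega> ` mu_admissible p q \<Omega>)"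
proof -
  have "rayleigh p q \<Omega> ` mu_admissible p q \<Omega> =
     {(\<integral>x. norm (g x) powr p \<partial>lebesgue_on \<Omega>)
        / (\<integral>x. \<bar>v x\<bar> powr q \<partial>lebesgue_on \<Omega>) powr (p / q) | v g.
      (v, g) \<in> W1p_graph p \<Omega> \<and> \<not> (AE x in lebesgue_on \<Omega>. v x = 0) \<and>
      (\<integral>x. \<bar>v x\<bar> powr (q - 2) * v x \<partial>lebesgue_on \<Omega>) = 0}"
    unfolding rayleigh_def mu_admissible_def signed_power_def by (auto simp: image_iff)
  then show ?thesis unfolding mu_def by simp
qed

lemma rayleigh_nonneg: "0 \<le> rayleigh p q \<Omega> f"
  by (auto simp: rayleigh_def split: prod.split intro!: divide_nonneg_nonneg Bochner_Integration.integral_nonneg)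

lemma mu_le_rayleigh: "f \<in> mu_admissible p q \<Omega> \<Longrightarrow> mu p q \<Omega> \<le> rayleigh p q \<Omega> f"
  unfolding mu_eq_Inf by (intro cInf_lower bdd_belowI[of _ 0]) (auto simp: rayleigh_nonneg)

text \<open>The infimum of the empty set of reals carries no information, so nonemptiness has to
  accompany lower bounds for \<open>mu\<close>.\<close>

lemma mu_greatest:
  "mu_admissible p q \<Omega> \<noteq> {} \<Longrightarrow> (\<And>f. f \<in> mu_admissible p q \<Omega> \<Longrightarrow> m \<le> rayleigh p q \<Omega> f) \<Longrightarrow> m \<le> mu p q \<Omega>"
  unfolding mu_eq_Inf by (intro cInf_greatest) auto

section \<open>Restriction, constants and linear functions in the Sobolev space\<close>

lemma Lp_subset:
  fixes f :: "'a::euclidean_space \<Rightarrow> 'b::euclidean_space"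
  assumes "f \<in> Lp p \<Omega>" "\<Omega>' \<subseteq> \<Omega>" "\<Omega> \<in> sets lebesgue" "\<Omega>' \<in> sets lebesgue"
  shows "f \<in> Lp p \<Omega>'"
proof -
  have "indicator \<Omega>' x *\<^sub>R (indicator \<Omega> x *\<^sub>R h x) = indicator \<Omega>' x *\<^sub>R h x"
    for x and h :: "'a \<Rightarrow> 'c::real_vector"
    using assms(2) by (auto simp: indicator_def)
  note ind = this[of _ f] this[of _ "\<lambda>x. norm (f x) powr p"]
  have m: "(\<lambda>x. indicator \<Omega> x *\<^sub>R f x) \<in> borel_measurable lebesgue"
    and i: "integrable lebesgue (\<lambda>x. indicator \<Omega> x *\<^sub>R norm (f x) powr p)"
    using assms by (simp_all add: Lp_def borel_measurable_restrict_space_iff integrable_restrict_space)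
  have "(\<lambda>x. indicator \<Omega>' x *\<^sub>R (indicator \<Omega> x *\<^sub>R f x)) \<in> borel_measurable lebesgue"
    by (rule borel_measurable_scaleR[OF borel_measurable_indicator[OF assms(4)] m])
  moreover have "integrable lebesgue (\<lambda>x. indicator \<Omega>' x *\<^sub>R (indicator \<Omega> x *\<^sub>R norm (f x) powr p))"
    by (rule integrable_mult_indicator[OF assms(4) i])
  ultimately show ?thesis
    using assms unfolding ind
    by (simp add: Lp_def borel_measurable_restrict_space_iff integrable_restrict_space)
qed

lemma W1p_graph_subset:
  fixes \<Omega> :: "'a::euclidean_space set"
  assumes "(v, g) \<in> W1p_graph p \<Omega>" "open \<Omega>" "open \<Omega>'" "\<Omega>' \<subseteq> \<Omega>"
  shows "(v, g) \<in> W1p_graph p \<Omega>'"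
proof -
  have "\<Omega> \<in> sets lebesgue" "\<Omega>' \<in> sets lebesgue" using assms by auto
  then show ?thesis
    using assms has_weak_gradient_subset[of \<Omega> \<Omega>' v g] Lp_subset[of v p \<Omega> \<Omega>'] Lp_subset[of g p \<Omega> \<Omega>']
    by (simp add: W1p_graph_def)
qed

lemma Lp_imp_integrable:
  assumes "v \<in> Lp p \<Omega>" "1 \<le> p" "open \<Omega>" "bounded \<Omega>"
  shows "integrable (lebesgue_on \<Omega>) v"
proof (rule Bochner_Integration.integrable_bound)
  interpret finite_measure "lebesgue_on \<Omega>"
    using assms by (intro lmeasurable_open_bounded)
  show "integrable (lebesgue_on \<Omega>) (\<lambda>x. 1 + norm (v x) powr p)"
    using assms by (intro Bochner_Integration.integrable_add) (auto simp: Lp_def)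
  show "v \<in> borel_measurable (lebesgue_on \<Omega>)" using assms by (simp add: Lp_def)
  have "y \<le> 1 + y powr p" if "0 \<le> y" for y :: real
  proof (cases "y \<le> 1")
    case True
    then show ?thesis using powr_ge_zero[of y p] by linarith
  next
    case False
    then show ?thesis using powr_mono[of 1 p y] assms(2) by simp
  qed
  then show "AE x in lebesgue_on \<Omega>. norm (v x) \<le> norm (1 + norm (v x) powr p)"
    by (intro AE_I2) (simp add: abs_of_nonneg add_nonneg_nonneg)
qed

lemma W1p_graph_diff_const:
  fixes \<Omega> :: "'a::euclidean_space set"
  assumes "(v, g) \<in> W1p_graph p \<Omega>" "1 \<le> p" "open \<Omega>" "bounded \<Omega>"
  shows "(\<lambda>x. v x - c, g) \<in> W1p_graph p \<Omega>"
proof -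
  have v: "v \<in> Lp p \<Omega>" using assms by (simp add: W1p_graph_def)
  have "(\<lambda>x. v x - c) \<in> Lp p \<Omega>"
    using v assms integrable_shift_powr[of "lebesgue_on \<Omega>" p v c]
    by (auto simp: Lp_def lmeasurable_open_bounded)
  then show ?thesis
    using assms has_weak_gradient_diff_const[of \<Omega> v g c] Lp_imp_integrable[OF v]
    by (simp add: W1p_graph_def)
qed

lemma W1p_graph_linear:
  fixes e :: "'a::euclidean_space"
  assumes "open \<Omega>" "bounded \<Omega>" "0 \<le> p"
  shows "(\<lambda>x. x \<bullet> e, \<lambda>_. e) \<in> W1p_graph p \<Omega>"
proof -
  interpret finite_measure "lebesgue_on \<Omega>"
    using assms by (intro lmeasurable_open_bounded)
  obtain R where R: "\<And>x. x \<in> \<Omega> \<Longrightarrow> norm x \<le> R"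
    using assms(2) unfolding bounded_iff by blast
  have m[measurable]: "(\<lambda>x. x \<bullet> e) \<in> borel_measurable (lebesgue_on \<Omega>)"
    by (intro measurable_restrict_space1 measurable_completion) simp
  have "norm (\<bar>x \<bullet> e\<bar> powr p) \<le> (R * norm e) powr p" if "x \<in> \<Omega>" for x
    using R[OF that] assms(3) Cauchy_Schwarz_ineq2[of x e] mult_right_mono[of "norm x" R "norm e"]
    by (auto intro!: powr_mono2)
  then have "integrable (lebesgue_on \<Omega>) (\<lambda>x. \<bar>x \<bullet> e\<bar> powr p)"
    by (intro integrable_const_bound[of _ "(R * norm e) powr p"] AE_I2) auto
  then show ?thesis
    using has_weak_gradient_linear[OF assms(1), of e 0] by (simp add: W1p_graph_def Lp_def)
qed

text \<open>When \<open>|v - c|^q\<close> is not integrable the Rayleigh quotient is \<open>x / 0 = 0\<close>, so the bound holds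
  without the Sobolev embedding.\<close>

lemma exists_centering_mu_le:
  fixes \<Omega> :: "'a::euclidean_space set"
  assumes vg: "(v, g) \<in> W1p_graph p \<Omega>" and "1 < p" "1 < q" "open \<Omega>" "bounded \<Omega>"
  shows "\<exists>c. \<forall>B>0. ennreal B \<le> (\<integral>\<^sup>+x. ennreal (\<bar>v x - c\<bar> powr q) \<partial>lebesgue_on \<Omega>) \<longrightarrow>
      mu_admissible p q \<Omega> \<noteq> {} \<and>
      mu p q \<Omega> \<le> (\<integral>x. norm (g x) powr p \<partial>lebesgue_on \<Omega>) / B powr (p / q)"
proof -
  let ?G = "\<integral>x. norm (g x) powr p \<partial>lebesgue_on \<Omega>"
  have v[measurable]: "v \<in> borel_measurable (lebesgue_on \<Omega>)"
    using vg by (simp add: W1p_graph_def Lp_def)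
  \<comment> \<open>The centring constant depends on v and the domain and comes without a bound.
    Hence B is quantified after c: a lower bound on the denominator has to be supplied for the
    constant that occurs.\<close>
  obtain c where c: "(\<integral>x. signed_power q (v x - c) \<partial>lebesgue_on \<Omega>) = 0"
    using exists_centering[OF lmeasurable_open_bounded(2) assms(3) v] assms by blast
  let ?w = "\<lambda>x. v x - c"
  show ?thesis
  proof (intro exI[of _ c] allI impI)
    fix B :: real
    assume B: "0 < B" and le: "ennreal B \<le> (\<integral>\<^sup>+x. ennreal (\<bar>?w x\<bar> powr q) \<partial>lebesgue_on \<Omega>)"
    have "\<not> (AE x in lebesgue_on \<Omega>. ?w x = 0)"
    proof
      assume "AE x in lebesgue_on \<Omega>. ?w x = 0"
      then have "(\<integral>\<^sup>+x. ennreal (\<bar>?w x\<bar> powr q) \<partial>lebesgue_on \<Omega>) = (\<integral>\<^sup>+x. 0 \<partial>lebesgue_on \<Omega>)"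
        by (intro nn_integral_cong_AE) (auto elim: AE_mp)
      then show False using le B by simp
    qed
    then have adm: "(?w, g) \<in> mu_admissible p q \<Omega>"
      using W1p_graph_diff_const[OF vg, of c] c assms by (simp add: mu_admissible_def)
    have "rayleigh p q \<Omega> (?w, g) \<le> ?G / B powr (p / q)"
    proof (cases "integrable (lebesgue_on \<Omega>) (\<lambda>x. \<bar>?w x\<bar> powr q)")
      case True
      then have "ennreal B \<le> ennreal (\<integral>x. \<bar>?w x\<bar> powr q \<partial>lebesgue_on \<Omega>)"
        using le by (simp add: nn_integral_eq_integral)
      then have "B \<le> (\<integral>x. \<bar>?w x\<bar> powr q \<partial>lebesgue_on \<Omega>)"
        by (subst (asm) ennreal_le_iff) (auto intro!: Bochner_Integration.integral_nonneg)
      then show ?thesis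
        using B assms(2,3) unfolding rayleigh_def
        by (auto intro!: divide_left_mono powr_mono2 mult_pos_pos Bochner_Integration.integral_nonneg)
    next
      case False
      then show ?thesis
        by (auto simp: rayleigh_def not_integrable_integral_eq intro!: divide_nonneg_nonneg Bochner_Integration.integral_nonneg)
    qed
    then show "mu_admissible p q \<Omega> \<noteq> {} \<and> mu p q \<Omega> \<le> ?G / B powr (p / q)"
      using mu_le_rayleigh[OF adm] adm by auto
  qed
qed

lemma diameter_open_pos:
  fixes \<Omega> :: "'a::euclidean_space set"
  assumes "open \<Omega>" "bounded \<Omega>" "\<Omega> \<noteq> {}"
  shows "0 < diameter \<Omega>"
proof -
  obtain x r where "0 < r" "ball x r \<subseteq> \<Omega>"
    using assms open_contains_ball by blast
  then show ?thesis
    using diameter_subset[OF _ assms(2), of "ball x r"] by simp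
qed

text \<open>The homothetic copies of \<open>\<Omega>\<close> of ratio 1/4 about two nearly diametral points are separated in
  the direction of the diameter, so the linear function in that direction is far from every
  constant on one of the two.\<close>

lemma convex_domain_mu_le:
  fixes \<Omega> :: "'a::euclidean_space set"
  assumes "1 < p" "1 < q" "convex_domain \<Omega>"
  shows "mu_admissible p q \<Omega> \<noteq> {}"
    and "mu p q \<Omega> \<le> measure lebesgue \<Omega>
      / ((diameter \<Omega> / 8) powr q * (measure lebesgue \<Omega> / 4 ^ DIM('a))) powr (p / q)"
proof -
  let ?d = "diameter \<Omega>"
  have \<Omega>: "open \<Omega>" "bounded \<Omega>" "convex \<Omega>" "\<Omega> \<noteq> {}"
    using assms(3) by (auto simp: convex_domain_def)
  note meas = lmeasurable_open_bounded[OF \<Omega>(1,2)]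
  have d: "0 < ?d" using diameter_open_pos \<Omega> by blast
  obtain x y where xy: "x \<in> \<Omega>" "y \<in> \<Omega>" "3 / 4 * ?d < dist x y"
    using diameter_lower_bounded[OF \<Omega>(2), of "3 / 4 * ?d"] d by auto
  then have "x \<noteq> y" using d by auto
  define e where "e = (y - x) /\<^sub>R norm (y - x)"
  have e: "norm e = 1" using \<open>x \<noteq> y\<close> by (simp add: e_def)
  have "y \<bullet> e - x \<bullet> e = ((y - x) \<bullet> (y - x)) / norm (y - x)"
    by (simp add: e_def inner_diff_left right_diff_distrib divide_inverse_commute)
  then have ye: "y \<bullet> e - x \<bullet> e = dist x y"
    by (simp add: dist_norm norm_minus_commute power2_eq_square dot_square_norm)
  \<comment> \<open>The image of \<Omega> under the homothety of centre u and ratio 1/4. By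
    convexity it stays in \<Omega>, and its points are within a quarter of the diameter of
    u.\<close>
  define T where "T = (\<lambda>u. (\<lambda>z. (- 3) *\<^sub>R u + 4 *\<^sub>R z) -` \<Omega>)"
  have T_sub: "T u \<subseteq> \<Omega>" and T_near: "\<And>z. z \<in> T u \<Longrightarrow> \<bar>z \<bullet> e - u \<bullet> e\<bar> \<le> ?d / 4" if "u \<in> \<Omega>" for u
  proof -
    show "T u \<subseteq> \<Omega>"
    proof
      fix z assume "z \<in> T u"
      then have "(3 / 4) *\<^sub>R u + (1 / 4) *\<^sub>R ((- 3) *\<^sub>R u + 4 *\<^sub>R z) \<in> \<Omega>"
        using convexD[OF \<Omega>(3) that, of _ "3/4" "1/4"] by (auto simp: T_def)
      moreover have "(3 / 4) *\<^sub>R u + (1 / 4) *\<^sub>R ((- 3) *\<^sub>R u + 4 *\<^sub>R z) = z"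
        by (simp add: algebra_simps)
      ultimately show "z \<in> \<Omega>" by simp
    qed
    fix z assume "z \<in> T u"
    then have "dist ((- 3) *\<^sub>R u + 4 *\<^sub>R z) u \<le> ?d"
      using diameter_bounded_bound[OF \<Omega>(2) _ that] by (auto simp: T_def)
    moreover have "(- 3) *\<^sub>R u + 4 *\<^sub>R z - u = 4 *\<^sub>R (z - u)"
      using scaleR_left_distrib[of 1 3 u] by (simp add: algebra_simps)
    ultimately have "norm (z - u) \<le> ?d / 4" by (simp add: dist_norm)
    then show "\<bar>z \<bullet> e - u \<bullet> e\<bar> \<le> ?d / 4"
      using Cauchy_Schwarz_ineq2[of "z - u" e] e by (simp add: inner_diff_left)
  qed
  define B where "B = (?d / 8) powr q * (measure lebesgue \<Omega> / 4 ^ DIM('a))"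
  have "0 < measure lebesgue \<Omega>"
    using \<Omega> meas(1) negligible_iff_measure0 open_not_negligible zero_less_measure_iff by blast
  then have B: "0 < B" using d by (simp add: B_def)
  have lower: "ennreal B \<le> (\<integral>\<^sup>+z. ennreal (\<bar>z \<bullet> e - c\<bar> powr q) \<partial>lebesgue_on \<Omega>)" for c
  proof -
    \<comment> \<open>The numbers x \<bullet> e and y \<bullet> e differ by more than 3/4 of the
      diameter, so c is at least 3/8 of it away from one of them. The copy about that point varies
      by at most 1/4, which leaves 3/8 - 1/4 = 1/8.\<close>
    obtain u where u: "u \<in> \<Omega>" "3 / 8 * ?d \<le> \<bar>c - u \<bullet> e\<bar>"
    proof (cases "3 / 8 * ?d \<le> \<bar>c - x \<bullet> e\<bar>")
      case False
      then have "3 / 8 * ?d \<le> \<bar>c - y \<bullet> e\<bar>" using ye xy(3) by linarith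
      then show ?thesis using that xy(2) by blast
    qed (use that xy(1) in blast)
    have far: "?d / 8 \<le> \<bar>z \<bullet> e - c\<bar>" if "z \<in> T u" for z
      using T_near[OF u(1) that] u(2) by linarith
    have Ts: "T u \<in> sets lebesgue"
      unfolding T_def by (rule vimage_affine_sets_lebesgue) (use meas in auto)
    have "emeasure lebesgue (T u) = ennreal (measure lebesgue \<Omega> / 4 ^ DIM('a))"
    proof -
      have "T u \<in> lmeasurable"
        using fmeasurableI2[OF meas(1) T_sub[OF u(1)] Ts] .
      then have "emeasure lebesgue (T u) = ennreal (measure lebesgue (T u))"
        by (intro emeasure_eq_ennreal_measure) (auto simp: fmeasurable_def)
      then show ?thesis
        using measure_vimage_affine[of 4 \<Omega> "(- 3) *\<^sub>R u"] meas by (simp add: T_def)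
    qed
    then have "ennreal B = ennreal ((?d / 8) powr q) * emeasure lebesgue (T u)"
      unfolding B_def by (subst ennreal_mult) auto
    also have "\<dots> = (\<integral>\<^sup>+z. ennreal ((?d / 8) powr q) * indicator (T u) z \<partial>lebesgue_on \<Omega>)"
      using Ts T_sub[OF u(1)] meas
      by (subst nn_integral_cmult_indicator) (auto simp: sets_restrict_space_iff emeasure_restrict_space)
    also have "\<dots> \<le> (\<integral>\<^sup>+z. ennreal (\<bar>z \<bullet> e - c\<bar> powr q) \<partial>lebesgue_on \<Omega>)"
      using far d assms(2)
      by (intro nn_integral_mono) (auto simp: indicator_def intro!: ennreal_leI powr_mono2)
    finally show ?thesis .
  qed
  \<comment> \<open>The gradient is a unit vector, so the numerator is the volume. As B does not
    depend on c, it serves whichever centring constant occurs.\<close>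
  have "(\<integral>z. norm e powr p \<partial>lebesgue_on \<Omega>) = measure lebesgue \<Omega>"
    using meas by (simp add: e measure_restrict_space)
  then show "mu_admissible p q \<Omega> \<noteq> {}" and "mu p q \<Omega> \<le> measure lebesgue \<Omega> / B powr (p / q)"
    using exists_centering_mu_le[OF W1p_graph_linear[OF \<Omega>(1,2), of p e] assms(1,2) \<Omega>(1,2)] lower B assms(1)
    by auto
qed

lemma mu_nonneg:
  assumes "1 < p" "1 < q" "convex_domain \<Omega>"
  shows "0 \<le> mu p q \<Omega>"
  using convex_domain_mu_le(1)[OF assms] by (intro mu_greatest rayleigh_nonneg)


subsection \<open>Scaling\<close>

lemma vimage_affine_eq_image:
  fixes a :: "'a::real_vector"
  assumes "t \<noteq> 0"
  shows "(\<lambda>x. a + t *\<^sub>R x) -` \<Omega> = (\<lambda>x. - (a /\<^sub>R t) + (1 / t) *\<^sub>R x) ` \<Omega>"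
  using affine_scaleR_inverse[OF assms, of a] by (auto simp only: vimage_eq image_iff set_eq_iff) metis+

lemma vimage_affine_vimage:
  fixes a :: "'a::real_vector"
  assumes "t \<noteq> 0"
  shows "(\<lambda>x. - (a /\<^sub>R t) + (1 / t) *\<^sub>R x) -` ((\<lambda>x. a + t *\<^sub>R x) -` \<Omega>) = \<Omega>"
  by (simp only: affine_scaleR_inverse[OF assms] vimage_def mem_Collect_eq Collect_mem_eq)

text \<open>A one-sided bound valid for every dilation, used again for the inverse map, gives
  equality.\<close>

lemma diameter_vimage_affine:
  fixes a :: "'a::euclidean_space"
  assumes "0 < t" "bounded \<Omega>"
  shows "diameter ((\<lambda>x. a + t *\<^sub>R x) -` \<Omega>) = diameter \<Omega> / t"
proof -
  have le: "diameter ((\<lambda>x. a + t *\<^sub>R x) -` S) \<le> diameter S / t" if "0 < t" "bounded S" for a t and S :: "'a set"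
  proof (rule diameter_le)
    show "(\<lambda>x. a + t *\<^sub>R x) -` S \<noteq> {} \<or> 0 \<le> diameter S / t"
      using diameter_ge_0[OF that(2)] that(1) by simp
    fix x y assume "x \<in> (\<lambda>x. a + t *\<^sub>R x) -` S" "y \<in> (\<lambda>x. a + t *\<^sub>R x) -` S"
    then have "dist (a + t *\<^sub>R x) (a + t *\<^sub>R y) \<le> diameter S"
      using diameter_bounded_bound[OF that(2)] by blast
    moreover have "(a + t *\<^sub>R x) - (a + t *\<^sub>R y) = t *\<^sub>R (x - y)"
      by (simp add: scaleR_diff_right)
    ultimately have "t * norm (x - y) \<le> diameter S"
      using that(1) by (simp add: dist_norm del: add_diff_cancel_left)
    then show "norm (x - y) \<le> diameter S / t"
      using that(1) by (simp add: le_divide_eq mult.commute)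
  qed
  have t: "t \<noteq> 0" using assms(1) by simp
  let ?V = "(\<lambda>x. a + t *\<^sub>R x) -` \<Omega>"
  have "bounded ?V"
    unfolding vimage_affine_eq_image[OF t]
    using bounded_translation[OF bounded_scaling[OF assms(2), of "1 / t"], of "- (a /\<^sub>R t)"]
    by (simp add: image_image)
  then have "diameter \<Omega> \<le> diameter ?V / (1 / t)"
    using le[of "1 / t" ?V "- (a /\<^sub>R t)"] assms(1) unfolding vimage_affine_vimage[OF t] by simp
  then show ?thesis
    using le[OF assms, of a] assms(1) by (simp add: field_simps)
qed

lemma convex_domain_vimage_affine:
  fixes a :: "'a::euclidean_space"
  assumes "0 < t" "convex_domain \<Omega>"
  shows "convex_domain ((\<lambda>x. a + t *\<^sub>R x) -` \<Omega>)"
proof -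
  have t: "t \<noteq> 0" using assms(1) by simp
  let ?V = "(\<lambda>x. a + t *\<^sub>R x) -` \<Omega>"
  have "?V = (\<lambda>x. - (a /\<^sub>R t) + x) ` (\<lambda>x. (1 / t) *\<^sub>R x) ` \<Omega>"
    unfolding vimage_affine_eq_image[OF t] by (simp add: image_image)
  moreover have "open ?V"
    using assms(2) by (intro open_vimage) (auto simp: convex_domain_def intro!: continuous_intros)
  ultimately show ?thesis
    using assms(2) unfolding convex_domain_def
    by (metis bounded_scaling bounded_translation convex_scaling convex_translation image_is_empty)
qed

text \<open>The chain rule contributes t^p, and the Jacobian t^(-N) in the numerator and t^(-N p /
  q) in the denominator; this is where the exponent comes from.\<close>

lemma mu_admissible_affine:
  fixes \<Omega> :: "'a::euclidean_space set" and a :: 'a and p q :: real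
  assumes "open \<Omega>" "0 < t" "0 < q" and f: "(v, g) \<in> mu_admissible p q \<Omega>"
  defines "f' \<equiv> (\<lambda>x. v (a + t *\<^sub>R x), \<lambda>x. t *\<^sub>R g (a + t *\<^sub>R x))"
  shows "f' \<in> mu_admissible p q ((\<lambda>x. a + t *\<^sub>R x) -` \<Omega>)"
    and "rayleigh p q ((\<lambda>x. a + t *\<^sub>R x) -` \<Omega>) f'
       = t powr (p + DIM('a) * p / q - DIM('a)) * rayleigh p q \<Omega> (v, g)"
proof -
  let ?V = "(\<lambda>x. a + t *\<^sub>R x) -` \<Omega>" and ?N = "real DIM('a)"
  have t: "t \<noteq> 0" using assms(2) by simp
  have \<Omega>: "\<Omega> \<in> sets lebesgue" using assms(1) by auto
  have V: "?V \<in> sets lebesgue" by (rule vimage_affine_sets_lebesgue[OF t \<Omega>])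
  have f1: "v \<in> Lp p \<Omega>" "g \<in> Lp p \<Omega>" "has_weak_gradient \<Omega> v g" "\<not> (AE x in lebesgue_on \<Omega>. v x = 0)"
    "(\<integral>x. signed_power q (v x) \<partial>lebesgue_on \<Omega>) = 0"
    using f by (auto simp: mu_admissible_def W1p_graph_def)
  have scale: "norm (t *\<^sub>R y) powr p = t powr p * norm y powr p" for y :: 'a
    using assms(2) by (simp add: powr_mult)
  have vt: "(\<lambda>x. v (a + t *\<^sub>R x)) \<in> Lp p ?V"
    using f1(1) lebesgue_on_measurable_affine[OF t \<Omega>, where f=v and a=a]
      lebesgue_on_integrable_affine[OF t \<Omega>, where f="\<lambda>x. norm (v x) powr p" and a=a]
    by (simp add: Lp_def)
  have gt: "(\<lambda>x. t *\<^sub>R g (a + t *\<^sub>R x)) \<in> Lp p ?V"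
    using f1(2) lebesgue_on_measurable_affine[OF t \<Omega>, where f=g and a=a]
      lebesgue_on_integrable_affine[OF t \<Omega>, where f="\<lambda>x. norm (g x) powr p" and a=a]
    unfolding Lp_def mem_Collect_eq scale
    by (auto intro!: borel_measurable_scaleR integrable_mult_right)
  have nz: "\<not> (AE x in lebesgue_on ?V. v (a + t *\<^sub>R x) = 0)"
  proof
    assume ae: "AE x in lebesgue_on ?V. v (a + t *\<^sub>R x) = 0"
    have "1 / t \<noteq> 0" using t by simp
    from AE_lebesgue_on_affine[OF this V ae, of "- (a /\<^sub>R t)"]
    show False
      using f1(4) unfolding vimage_affine_vimage[OF t] affine_scaleR_inverse[OF t] by simp
  qed
  have "(\<integral>x. signed_power q (v (a + t *\<^sub>R x)) \<partial>lebesgue_on ?V) = 0"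
    using lebesgue_on_integral_affine[OF t \<Omega>, where f="\<lambda>x. signed_power q (v x)" and a=a] f1(5) by simp
  then show "f' \<in> mu_admissible p q ?V"
    using vt gt nz has_weak_gradient_affine[OF assms(1,2) f1(3), of a]
    by (simp add: f'_def mu_admissible_def W1p_graph_def)
  have tN: "\<bar>t\<bar> ^ DIM('a) = t powr ?N"
    using assms(2) by (simp add: powr_realpow)
  define G where "G = (\<integral>x. norm (g x) powr p \<partial>lebesgue_on \<Omega>)"
  define D where "D = (\<integral>x. \<bar>v x\<bar> powr q \<partial>lebesgue_on \<Omega>)"
  have D: "0 \<le> D" unfolding D_def by (intro Bochner_Integration.integral_nonneg) auto
  have "(\<integral>x. norm (t *\<^sub>R g (a + t *\<^sub>R x)) powr p \<partial>lebesgue_on ?V) = t powr p * (G / t powr ?N)"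
    unfolding scale using lebesgue_on_integral_affine[OF t \<Omega>, where f="\<lambda>x. norm (g x) powr p" and a=a]
    by (simp add: G_def tN divide_inverse_commute)
  moreover have "(\<integral>x. \<bar>v (a + t *\<^sub>R x)\<bar> powr q \<partial>lebesgue_on ?V) = D / t powr ?N"
    using lebesgue_on_integral_affine[OF t \<Omega>, where f="\<lambda>x. \<bar>v x\<bar> powr q" and a=a]
    by (simp add: D_def tN divide_inverse_commute)
  ultimately have "rayleigh p q ?V f' = t powr p * (G / t powr ?N) / (D / t powr ?N) powr (p / q)"
    by (simp add: rayleigh_def f'_def)
  also have "(D / t powr ?N) powr (p / q) = D powr (p / q) / t powr (?N * p / q)"
    using D by (simp add: powr_divide powr_powr)
  also have "t powr p * (G / t powr ?N) / (D powr (p / q) / t powr (?N * p / q))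
      = (t powr p * t powr (?N * p / q) / t powr ?N) * (G / D powr (p / q))"
    by simp
  also have "t powr p * t powr (?N * p / q) / t powr ?N = t powr (p + ?N * p / q - ?N)"
    using t by (simp add: powr_add powr_diff)
  finally show "rayleigh p q ?V f' = t powr (p + DIM('a) * p / q - DIM('a)) * rayleigh p q \<Omega> (v, g)"
    by (simp add: rayleigh_def G_def D_def)
qed

lemma mu_affine:
  fixes \<Omega> :: "'a::euclidean_space set" and p q :: real
  assumes "1 < p" "1 < q" "convex_domain \<Omega>" "0 < t"
  shows "mu p q ((\<lambda>x. a + t *\<^sub>R x) -` \<Omega>) = t powr (p + DIM('a) * p / q - DIM('a)) * mu p q \<Omega>"
proof -
  define s where "s = p + DIM('a) * p / q - DIM('a)"
  \<comment> \<open>Stated for all domains and dilations, so that it can be applied once more to the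
    inverse map for the reverse inequality.\<close>
  have le: "mu p q ((\<lambda>x. a + t *\<^sub>R x) -` \<Omega>) \<le> t powr s * mu p q \<Omega>"
    if "convex_domain \<Omega>" "0 < t" for a t and \<Omega> :: "'a set"
  proof -
    let ?V = "(\<lambda>x. a + t *\<^sub>R x) -` \<Omega>"
    have "mu p q ?V / t powr s \<le> mu p q \<Omega>"
    proof (rule mu_greatest)
      show "mu_admissible p q \<Omega> \<noteq> {}"
        by (rule convex_domain_mu_le(1)[OF assms(1,2) that(1)])
      fix f assume f: "f \<in> mu_admissible p q \<Omega>"
      obtain v g where vg: "f = (v, g)" by (cases f)
      have "open \<Omega>" "0 < q" using that assms(2) by (auto simp: convex_domain_def)
      from mu_admissible_affine[OF this(1) that(2) this(2) f[unfolded vg], of a]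
      have "mu p q ?V \<le> t powr s * rayleigh p q \<Omega> f"
        using mu_le_rayleigh unfolding vg s_def by metis
      then show "mu p q ?V / t powr s \<le> rayleigh p q \<Omega> f"
        using that(2) by (simp add: divide_le_eq mult.commute)
    qed
    then show ?thesis using that(2) by (simp add: divide_le_eq mult.commute)
  qed
  have t: "t \<noteq> 0" using assms(4) by simp
  let ?V = "(\<lambda>x. a + t *\<^sub>R x) -` \<Omega>"
  have "mu p q \<Omega> \<le> (1 / t) powr s * mu p q ?V"
    using le[OF convex_domain_vimage_affine[OF assms(4,3)], of "1 / t" "- (a /\<^sub>R t)" a] assms(4)
    unfolding vimage_affine_vimage[OF t] by simp
  also have "(1 / t) powr s = 1 / t powr s"
    using assms(4) by (simp add: powr_divide)
  finally have "t powr s * mu p q \<Omega> \<le> mu p q ?V"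
    using assms(4) by (simp add: field_simps)
  with le[OF assms(3,4), of a] show ?thesis unfolding s_def by linarith
qed

text \<open>By convexity of \<open>c \<mapsto> \<integral>|v - c|^q\<close>, whose derivative vanishes at \<open>c = 0\<close>.\<close>

lemma centered_nn_integral_le:
  fixes v :: "'b \<Rightarrow> real"
  assumes "finite_measure M" "1 < q" and [measurable]: "v \<in> borel_measurable M"
    and zero: "(\<integral>x. signed_power q (v x) \<partial>M) = 0"
  shows "(\<integral>\<^sup>+x. ennreal (\<bar>v x\<bar> powr q) \<partial>M) \<le> (\<integral>\<^sup>+x. ennreal (\<bar>v x - c\<bar> powr q) \<partial>M)"
proof (cases "integrable M (\<lambda>x. \<bar>v x - c\<bar> powr q)")
  case False
  have "(\<integral>\<^sup>+x. ennreal (\<bar>v x - c\<bar> powr q) \<partial>M) = \<infinity>"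
    using False by (subst (asm) integrable_iff_bounded) (simp add: less_top[symmetric])
  then show ?thesis by simp
next
  case True
  interpret finite_measure M by fact
  have int: "integrable M (\<lambda>x. \<bar>v x\<bar> powr q)"
    using integrable_shift_powr[OF assms(1), of q "\<lambda>x. v x - c" "- c"] True assms(2) by simp
  have sint: "integrable M (\<lambda>x. signed_power q (v x))"
  proof (rule Bochner_Integration.integrable_bound)
    show "integrable M (\<lambda>x. 1 + \<bar>v x\<bar> powr q)" using int by simp
    have "\<bar>y\<bar> powr (q - 1) \<le> 1 + \<bar>y\<bar> powr q" for y :: real
    proof (cases "\<bar>y\<bar> \<le> 1")
      case True
      then have "\<bar>y\<bar> powr (q - 1) \<le> 1 powr (q - 1)" using assms(2) by (intro powr_mono2) auto
      then show ?thesis by (simp add: add_increasing2)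
    next
      case False
      then have "\<bar>y\<bar> powr (q - 1) \<le> \<bar>y\<bar> powr q" by (intro powr_mono) auto
      then show ?thesis by simp
    qed
    then show "AE x in M. norm (signed_power q (v x)) \<le> norm (1 + \<bar>v x\<bar> powr q)"
      by (intro AE_I2) (simp add: abs_signed_power abs_of_nonneg add_nonneg_nonneg)
  qed measurable
  have "(\<integral>x. \<bar>v x\<bar> powr q \<partial>M) = (\<integral>x. \<bar>v x\<bar> powr q - q * c * signed_power q (v x) \<partial>M)"
    using int sint zero by simp
  also have "\<dots> \<le> (\<integral>x. \<bar>v x - c\<bar> powr q \<partial>M)"
    using int sint True abs_diff_powr_ge_tangent[OF assms(2)] by (intro integral_mono) auto
  finally show ?thesis
    using int True by (simp add: nn_integral_eq_integral ennreal_leI)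
qed


subsection \<open>Upper semicontinuity\<close>

lemma abs_powr_tendsto_top:
  fixes f :: "nat \<Rightarrow> real"
  assumes "1 \<le> q" "filterlim (\<lambda>n. \<bar>f n\<bar>) at_top sequentially"
  shows "(\<lambda>n. ennreal (\<bar>f n\<bar> powr q)) \<longlonglongrightarrow> \<infinity>"
proof -
  have "eventually (\<lambda>n. \<bar>f n\<bar> \<le> \<bar>f n\<bar> powr q) sequentially"
    using filterlim_at_top[THEN iffD1, OF assms(2), THEN spec, of 1]
  proof eventually_elim
    case (elim n)
    then have "\<bar>f n\<bar> powr 1 \<le> \<bar>f n\<bar> powr q" using assms(1) by (intro powr_mono) auto
    then show ?case using elim by simp
  qed
  then have "filterlim (\<lambda>n. \<bar>f n\<bar> powr q) at_top sequentially"
    by (rule filterlim_at_top_mono[OF assms(2)])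
  then show ?thesis
    by (simp add: ennreal_tendsto_top_eq_at_top)
qed

text \<open>The shifts \<open>c n\<close> need not be bounded: a subsequence converges in the extended reals, and at an
  infinite limit the integrands tend to infinity.\<close>

lemma eventually_nn_integral_shift_ge:
  fixes v :: "'a::euclidean_space \<Rightarrow> real" and c :: "nat \<Rightarrow> real"
  assumes "1 < q" "open K" "bounded K" "K \<noteq> {}" and v: "v \<in> borel_measurable (lebesgue_on K)"
    and zero: "(\<integral>x. signed_power q (v x) \<partial>lebesgue_on K) = 0"
    and U: "\<And>n. open (U n)" "\<And>n. U n \<subseteq> K" "\<And>x. x \<in> K \<Longrightarrow> eventually (\<lambda>n. x \<in> U n) sequentially"
    and B: "ennreal B < (\<integral>\<^sup>+x. ennreal (\<bar>v x\<bar> powr q) \<partial>lebesgue_on K)"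
  shows "eventually (\<lambda>n. ennreal B \<le> (\<integral>\<^sup>+x. ennreal (\<bar>v x - c n\<bar> powr q) \<partial>lebesgue_on (U n))) sequentially"
proof (rule ccontr)
  let ?I = "\<lambda>n. \<integral>\<^sup>+x. ennreal (\<bar>v x - c n\<bar> powr q) \<partial>lebesgue_on (U n)"
  note [measurable] = v
  assume "\<not> ?thesis"
  then obtain r where r: "strict_mono (r::nat\<Rightarrow>nat)" and I: "\<And>n. ?I (r n) < ennreal B"
    by (auto dest!: not_eventually_sequentiallyD simp: not_le)
  obtain r' :: "nat \<Rightarrow> nat" and l :: ereal where r': "strict_mono r'"
    and l: "((\<lambda>n. ereal (c (r n))) \<circ> r') \<longlonglongrightarrow> l"
    using limsup_subseq_lim[of "\<lambda>n. ereal (c (r n))"] by blast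
  define s where "s = r \<circ> r'"
  have s: "strict_mono s" unfolding s_def by (rule strict_mono_o[OF r r'])
  have cl: "(\<lambda>n. ereal (c (s n))) \<longlonglongrightarrow> l" using l by (simp add: s_def o_def)
  define L where "L = (\<lambda>x. if \<bar>l\<bar> = \<infinity> then \<infinity> else ennreal (\<bar>v x - real_of_ereal l\<bar> powr q))"
  have lim: "(\<lambda>n. ennreal (\<bar>v x - c (s n)\<bar> powr q)) \<longlonglongrightarrow> L x" for x
  proof (cases l)
    case (real r)
    then have "(\<lambda>n. c (s n)) \<longlonglongrightarrow> r" using cl by simp
    then have "(\<lambda>n. \<bar>v x - c (s n)\<bar> powr q) \<longlonglongrightarrow> \<bar>v x - r\<bar> powr q"
      using assms(1) by (intro tendsto_powr' tendsto_intros) auto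
    then show ?thesis using real by (simp add: L_def tendsto_ennrealI)
  next
    case PInf
    then have "filterlim (\<lambda>n. c (s n)) at_top sequentially"
      using cl by (simp add: tendsto_PInfty_eq_at_top)
    then have "filterlim (\<lambda>n. - v x + c (s n)) at_top sequentially"
      by (rule filterlim_tendsto_add_at_top[OF tendsto_const])
    then have "filterlim (\<lambda>n. \<bar>v x - c (s n)\<bar>) at_top sequentially"
      by (rule filterlim_at_top_mono) (rule always_eventually, simp add: abs_if)
    then show ?thesis using PInf abs_powr_tendsto_top[of q "\<lambda>n. v x - c (s n)"] assms(1) by (simp add: L_def)
  next
    case MInf
    then have "(\<lambda>n. ereal (- c (s n))) \<longlonglongrightarrow> \<infinity>"
      using tendsto_uminus_ereal[OF cl] by simp
    then have "filterlim (\<lambda>n. - c (s n)) at_top sequentially"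
      by (simp add: tendsto_PInfty_eq_at_top)
    then have "filterlim (\<lambda>n. v x + - c (s n)) at_top sequentially"
      by (rule filterlim_tendsto_add_at_top[OF tendsto_const])
    then have "filterlim (\<lambda>n. \<bar>v x - c (s n)\<bar>) at_top sequentially"
      by (rule filterlim_at_top_mono) (rule always_eventually, simp add: abs_if)
    then show ?thesis using MInf abs_powr_tendsto_top[of q "\<lambda>n. v x - c (s n)"] assms(1) by (simp add: L_def)
  qed
  \<comment> \<open>Extension by zero puts all integrals on the fixed domain K, as Fatou's lemma
    requires. Each x in K is eventually in the sets U, so the cut-off does not change the pointwise
    limit.\<close>
  define u where "u = (\<lambda>n x. ennreal (\<bar>v x - c (s n)\<bar> powr q) * indicator (U (s n)) x)"
  have K: "K \<in> sets lebesgue" using assms(2) by auto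
  have OK: "U n \<in> sets (lebesgue_on K)" for n
    using U(1,2)[of n] K by (auto simp: sets_restrict_space_iff)
  have "L x = liminf (\<lambda>n. u n x)" if "x \<in> K" for x
  proof -
    have "eventually (\<lambda>n. x \<in> U (s n)) sequentially"
      using U(3)[OF that] s by (rule eventually_subseq[rotated])
    then have "eventually (\<lambda>n. ennreal (\<bar>v x - c (s n)\<bar> powr q) = u n x) sequentially"
      by eventually_elim (simp add: u_def)
    then have "(\<lambda>n. u n x) \<longlonglongrightarrow> L x"
      using lim[of x] by (simp add: tendsto_cong)
    then show ?thesis by (intro lim_imp_Liminf[symmetric]) auto
  qed
  then have "(\<integral>\<^sup>+x. L x \<partial>lebesgue_on K) = (\<integral>\<^sup>+x. liminf (\<lambda>n. u n x) \<partial>lebesgue_on K)"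
    by (intro nn_integral_cong) simp
  also have "\<dots> \<le> liminf (\<lambda>n. \<integral>\<^sup>+x. u n x \<partial>lebesgue_on K)"
    using OK by (intro nn_integral_liminf) (simp add: u_def)
  also have "\<dots> \<le> liminf (\<lambda>n::nat. ennreal B)"
  proof (intro Liminf_mono always_eventually allI)
    fix n
    have sub: "U (s n) \<inter> K = U (s n)" using U(2) by auto
    have "(\<integral>\<^sup>+x. u n x \<partial>lebesgue_on K) = (\<integral>\<^sup>+x. ennreal (\<bar>v x - c (s n)\<bar> powr q) \<partial>restrict_space (lebesgue_on K) (U (s n)))"
      using OK sub unfolding u_def
      by (subst nn_integral_restrict_space) auto
    also have "restrict_space (lebesgue_on K) (U (s n)) = lebesgue_on (U (s n))"
      using K U(1)[of "s n"] U(2)[of "s n"] by (subst restrict_restrict_space) (auto simp: Int_absorb1)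
    finally show "(\<integral>\<^sup>+x. u n x \<partial>lebesgue_on K) \<le> ennreal B"
      using I[of "r' n"] by (simp add: s_def less_imp_le)
  qed
  also have "\<dots> = ennreal B" by (simp add: Liminf_const)
  finally have LB: "(\<integral>\<^sup>+x. L x \<partial>lebesgue_on K) \<le> ennreal B" .
  \<comment> \<open>For infinite l the integrand L is infinite on a set of positive measure. For
    finite l, centring makes the integral of |v - l|^q at least that of |v|^q, which exceeds
    B.\<close>
  show False
  proof (cases "\<bar>l\<bar> = \<infinity>")
    case True
    have "emeasure lebesgue K \<noteq> 0"
      using assms(2,4) open_not_negligible[of K] K by (auto simp: negligible_iff_null_sets null_sets_def)
    then have "(\<integral>\<^sup>+x. L x \<partial>lebesgue_on K) = \<infinity>"
      using True K by (simp add: L_def emeasure_restrict_space ennreal_top_mult)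
    then show False using LB by (simp add: top_unique)
  next
    case False
    then have "(\<integral>\<^sup>+x. ennreal (\<bar>v x\<bar> powr q) \<partial>lebesgue_on K) \<le> (\<integral>\<^sup>+x. L x \<partial>lebesgue_on K)"
      using centered_nn_integral_le[OF lmeasurable_open_bounded(2)[OF assms(2,3)] assms(1) v zero]
      by (simp add: L_def)
    then show False using LB B by simp
  qed
qed

text \<open>A competitor on K, restricted to \<open>U n\<close>, keeps at most its gradient energy,
  and after recentring its denominator eventually exceeds every bound B below the one on K. The
  inner sets need not be convex, since only upper bounds for their \<open>mu\<close> are
  used.\<close>

lemma mu_upper_semicontinuous:
  fixes K :: "'a::euclidean_space set"
  assumes p: "1 < p" and q: "1 < q" and K: "convex_domain K"
    and U: "\<And>n. open (U n)" "\<And>n. U n \<subseteq> K" "\<And>x. x \<in> K \<Longrightarrow> eventually (\<lambda>n. x \<in> U n) sequentially"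
    and lim: "(\<lambda>n. mu p q (U n)) \<longlonglongrightarrow> S"
  shows "S \<le> mu p q K"
proof (rule mu_greatest)
  show "mu_admissible p q K \<noteq> {}" by (rule convex_domain_mu_le(1)[OF p q K])
  fix f assume f: "f \<in> mu_admissible p q K"
  obtain v g where vg: "f = (v, g)" by (cases f)
  have K': "open K" "bounded K" "K \<noteq> {}" using K by (auto simp: convex_domain_def)
  have OB: "bounded (U n)" for n using U(2) K'(2) bounded_subset by blast
  note Ks = lmeasurable_open_bounded[OF K'(1,2)]
  have W: "(v, g) \<in> W1p_graph p K" and nz: "\<not> (AE x in lebesgue_on K. v x = 0)"
    and zero: "(\<integral>x. signed_power q (v x) \<partial>lebesgue_on K) = 0"
    using f by (auto simp: mu_admissible_def vg)
  have v[measurable]: "v \<in> borel_measurable (lebesgue_on K)"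
    and gint: "integrable (lebesgue_on K) (\<lambda>x. norm (g x) powr p)"
    using W by (auto simp: W1p_graph_def Lp_def)
  define G where "G = (\<integral>x. norm (g x) powr p \<partial>lebesgue_on K)"
  have G: "0 \<le> G" unfolding G_def by (intro Bochner_Integration.integral_nonneg) auto
  let ?J = "\<integral>\<^sup>+x. ennreal (\<bar>v x\<bar> powr q) \<partial>lebesgue_on K"
  have "\<exists>c. \<forall>B>0. ennreal B \<le> (\<integral>\<^sup>+x. ennreal (\<bar>v x - c\<bar> powr q) \<partial>lebesgue_on (U n)) \<longrightarrow>
      mu p q (U n) \<le> (\<integral>x. norm (g x) powr p \<partial>lebesgue_on (U n)) / B powr (p / q)" for n
    using exists_centering_mu_le[OF W1p_graph_subset[OF W K'(1) U(1,2)] p q U(1) OB] by blast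
  then obtain c where c: "\<And>n B. 0 < B \<Longrightarrow> ennreal B \<le> (\<integral>\<^sup>+x. ennreal (\<bar>v x - c n\<bar> powr q) \<partial>lebesgue_on (U n)) \<Longrightarrow>
      mu p q (U n) \<le> (\<integral>x. norm (g x) powr p \<partial>lebesgue_on (U n)) / B powr (p / q)"
    by metis
  have gO: "(\<integral>x. norm (g x) powr p \<partial>lebesgue_on (U n)) \<le> G" for n
  proof -
    have On: "U n \<in> sets lebesgue" using U(1)[of n] by auto
    have i: "integrable lebesgue (\<lambda>x. indicator K x *\<^sub>R norm (g x) powr p)"
      using gint Ks(3) by (simp add: integrable_restrict_space)
    have "(\<integral>x. indicator (U n) x *\<^sub>R (indicator K x *\<^sub>R norm (g x) powr p) \<partial>lebesgue)
        \<le> (\<integral>x. indicator K x *\<^sub>R norm (g x) powr p \<partial>lebesgue)"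
      by (intro integral_mono integrable_mult_indicator i On) (auto simp: indicator_def)
    moreover have "(\<lambda>x. indicator (U n) x *\<^sub>R (indicator K x *\<^sub>R norm (g x) powr p))
        = (\<lambda>x. indicator (U n) x *\<^sub>R norm (g x) powr p)"
      using U(2)[of n] by (auto simp: indicator_def fun_eq_iff)
    ultimately show ?thesis
      using Ks(3) On by (simp add: G_def integral_restrict_space)
  qed
  have SB: "S \<le> G / B powr (p / q)" if "0 < B" "ennreal B < ?J" for B
  proof (rule tendsto_upperbound[OF lim])
    have ev: "eventually (\<lambda>n. ennreal B \<le> (\<integral>\<^sup>+x. ennreal (\<bar>v x - c n\<bar> powr q) \<partial>lebesgue_on (U n))) sequentially"
      by (rule eventually_nn_integral_shift_ge[OF q K' v zero U(1,2) _ that(2)]) (rule U(3))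
    show "eventually (\<lambda>n. mu p q (U n) \<le> G / B powr (p / q)) sequentially"
      using ev
    proof eventually_elim
      case (elim n)
      have "mu p q (U n) \<le> (\<integral>x. norm (g x) powr p \<partial>lebesgue_on (U n)) / B powr (p / q)"
        by (rule c[OF that(1) elim])
      also have "\<dots> \<le> G / B powr (p / q)"
        using gO that(1) by (intro divide_right_mono) auto
      finally show ?case .
    qed
  qed simp
  show "S \<le> rayleigh p q K f"
  proof (cases "integrable (lebesgue_on K) (\<lambda>x. \<bar>v x\<bar> powr q)")
    case True
    define D where "D = (\<integral>x. \<bar>v x\<bar> powr q \<partial>lebesgue_on K)"
    have JD: "?J = ennreal D" using True by (simp add: D_def nn_integral_eq_integral)
    have "D \<noteq> 0"
    proof
      assume "D = 0"
      then have "AE x in lebesgue_on K. \<bar>v x\<bar> powr q = 0"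
        using integral_nonneg_eq_0_iff_AE[OF True] by (simp add: D_def)
      then show False using nz by simp
    qed
    moreover have "0 \<le> D" unfolding D_def by (intro Bochner_Integration.integral_nonneg) auto
    ultimately have D: "0 < D" by simp
    \<comment> \<open>The bound is available strictly below D; continuity from the left reaches D
      itself.\<close>
    have "S \<le> G / D powr (p / q)"
    proof (rule tendsto_lowerbound)
      show "((\<lambda>B. G / B powr (p / q)) \<longlongrightarrow> G / D powr (p / q)) (at_left D)"
        using D by (intro tendsto_intros) auto
      have "eventually (\<lambda>B. B \<in> {0<..<D}) (at_left D)"
        using D by (rule eventually_at_left_real)
      then show "eventually (\<lambda>B. S \<le> G / B powr (p / q)) (at_left D)"
        by eventually_elim (rule SB, auto simp: JD ennreal_less_iff)
    qed simp
    then show ?thesis by (simp add: vg rayleigh_def G_def D_def)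
  next
    \<comment> \<open>The quotient is 0 by convention, so S \<le> 0 is required; it follows because
      B may be arbitrarily large.\<close>
    case False
    then have "?J = \<infinity>"
      by (subst (asm) integrable_iff_bounded) (simp add: less_top[symmetric])
    then have S: "S \<le> G / B powr (p / q)" if "0 < B" for B using SB that by simp
    have "S \<le> 0"
    proof (rule tendsto_lowerbound)
      show "(\<lambda>n. G / real n) \<longlonglongrightarrow> 0" by (rule lim_const_over_n)
      show "eventually (\<lambda>n. S \<le> G / real n) sequentially"
        using eventually_gt_at_top[of 0]
      proof eventually_elim
        case (elim n)
        \<comment> \<open>The choice B = n^(q / p) turns B^(p / q) into n.\<close>
        then show ?case using S[of "real n powr (q / p)"] p q by (simp add: powr_powr)
      qed
    qed simp
    then show ?thesis using rayleigh_nonneg[of p q K f] by linarith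
  qed
qed


subsection \<open>Blaschke's selection theorem\<close>

lemma infdist_lessD:
  assumes "A \<noteq> {}" "infdist x A < e"
  obtains a where "a \<in> A" "dist x a < e"
proof -
  have "(INF a\<in>A. dist x a) < e" using assms by (simp add: infdist_notempty)
  then show ?thesis using that assms(1) by (auto simp: cINF_less_iff bdd_belowI2[where m=0])
qed

text \<open>The distance functions of the sets are equicontinuous; the limit body is the zero set of a
  uniform limit of a subsequence.\<close>

lemma Blaschke_selection:
  fixes A :: "nat \<Rightarrow> 'a::euclidean_space set"
  assumes A: "\<And>n. A n \<noteq> {}" "\<And>n. convex (A n)" "\<And>n. A n \<subseteq> cball 0 R"
    and vol: "\<And>n. A n \<in> lmeasurable" "\<And>n. \<delta> \<le> measure lebesgue (A n)" "0 < \<delta>"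
  obtains r :: "nat \<Rightarrow> nat" and K
  where "strict_mono r" "convex_domain K"
    and "\<And>x. x \<in> K \<Longrightarrow> \<exists>e>0. eventually (\<lambda>n. ball x e \<subseteq> A (r n)) sequentially"
    and "\<And>W. open W \<Longrightarrow> closure K \<subseteq> W \<Longrightarrow> eventually (\<lambda>n. A (r n) \<subseteq> W) sequentially"
proof -
  let ?S = "cball (0::'a) R"
  have lip: "\<bar>infdist x (A n) - infdist y (A n)\<bar> \<le> dist x y" for x y n
    using infdist_triangle[of x "A n" y] infdist_triangle[of y "A n" x] by (auto simp: dist_commute)
  obtain f r where cont: "continuous_on ?S f" and r: "strict_mono (r::nat\<Rightarrow>nat)"
    and unif: "\<And>e. 0 < e \<Longrightarrow> \<exists>N. \<forall>n x. n \<ge> N \<and> x \<in> ?S \<longrightarrow> norm (infdist x (A (r n)) - f x) < e"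
  proof (rule Arzela_Ascoli[of ?S "\<lambda>n x. infdist x (A n)" "2 * R"])
    fix n and x :: 'a assume x: "x \<in> ?S"
    obtain a where a: "a \<in> A n" using A(1) by blast
    have "infdist x (A n) \<le> dist x a" by (rule infdist_le[OF a])
    also have "\<dots> \<le> 2 * R"
      using x a A(3)[of n] dist_triangle[of x a 0] by (auto simp: dist_commute)
    finally show "norm (infdist x (A n)) \<le> 2 * R" by (simp add: infdist_nonneg)
  next
    fix x :: 'a and e :: real assume "0 < e"
    then show "\<exists>d>0. \<forall>n y. y \<in> ?S \<and> norm (x - y) < d \<longrightarrow> norm (infdist x (A n) - infdist y (A n)) < e"
      using lip by (intro exI[of _ e]) (auto simp: dist_norm intro: le_less_trans)
  qed auto
  have ev: "eventually (\<lambda>n. \<forall>x\<in>?S. \<bar>infdist x (A (r n)) - f x\<bar> < e) sequentially" if "0 < e" for e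
    using unif[OF that] unfolding eventually_sequentially real_norm_def by blast
  have f_nonneg: "0 \<le> f x" if "x \<in> ?S" for x
  proof (rule field_le_epsilon)
    fix e :: real assume "0 < e"
    then obtain n where "\<forall>x\<in>?S. \<bar>infdist x (A (r n)) - f x\<bar> < e"
      using eventually_happens[OF ev] by auto
    then have "\<bar>infdist x (A (r n)) - f x\<bar> < e" using that by blast
    then show "0 \<le> f x + e" using infdist_nonneg[of x "A (r n)"] by linarith
  qed
  define C where "C = {x \<in> ?S. f x = 0}"
  have "closed C"
    unfolding C_def by (rule continuous_closed_preimage_constant[OF cont]) simp
  have CS: "C \<subseteq> ?S" by (auto simp: C_def)
  have near: "eventually (\<lambda>n. \<forall>x\<in>C. \<exists>a\<in>A (r n). dist x a < e) sequentially" if "0 < e" for e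
    using ev[OF that]
  proof eventually_elim
    case (elim n)
    show ?case
    proof
      fix x assume "x \<in> C"
      then have "\<bar>infdist x (A (r n)) - f x\<bar> < e" "f x = 0" using elim CS by (auto simp only: C_def)
      then have "infdist x (A (r n)) < e" by linarith
      then show "\<exists>a\<in>A (r n). dist x a < e" using A(1) by (metis infdist_lessD)
    qed
  qed
  have "convex C"
  proof (rule convexI)
    fix x y and u w :: real
    assume xy: "x \<in> C" "y \<in> C" and uw: "0 \<le> u" "0 \<le> w" "u + w = 1"
    let ?z = "u *\<^sub>R x + w *\<^sub>R y"
    have zS: "?z \<in> ?S" by (rule convexD[OF convex_cball]) (use xy uw CS in auto)
    have "f ?z \<le> 0"
    proof (rule field_le_epsilon)
      fix e :: real assume "0 < e"
      then have "0 < e / 2" by simp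
      obtain n where n: "\<forall>x\<in>C. \<exists>a\<in>A (r n). dist x a < e / 2" "\<forall>x\<in>?S. \<bar>infdist x (A (r n)) - f x\<bar> < e / 2"
        using eventually_happens[OF eventually_conj[OF near[OF \<open>0 < e / 2\<close>] ev[OF \<open>0 < e / 2\<close>]]] by auto
      obtain a b where ab: "a \<in> A (r n)" "dist x a < e / 2" "b \<in> A (r n)" "dist y b < e / 2"
        using n(1) xy by meson
      have "infdist ?z (A (r n)) \<le> dist ?z (u *\<^sub>R a + w *\<^sub>R b)"
        using convexD[OF A(2) ab(1,3) uw] by (rule infdist_le)
      also have "\<dots> = norm (u *\<^sub>R (x - a) + w *\<^sub>R (y - b))"
        by (simp add: dist_norm algebra_simps)
      also have "\<dots> \<le> u * dist x a + w * dist y b"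
        using uw norm_triangle_ineq[of "u *\<^sub>R (x - a)" "w *\<^sub>R (y - b)"] by (simp add: dist_norm)
      also have "\<dots> \<le> u * (e / 2) + w * (e / 2)"
        using uw ab by (intro add_mono mult_left_mono) auto
      also have "\<dots> = e / 2" using uw by (simp flip: distrib_right)
      finally have "infdist ?z (A (r n)) \<le> e / 2" .
      moreover have "\<bar>infdist ?z (A (r n)) - f ?z\<bar> < e / 2" using n(2) zS by blast
      ultimately show "f ?z \<le> 0 + e" by linarith
    qed
    then show "?z \<in> C" using f_nonneg[OF zS] zS by (simp add: C_def)
  qed
  have outer: "eventually (\<lambda>n. A (r n) \<subseteq> W) sequentially" if W: "open W" "C \<subseteq> W" for W
  proof -
    \<comment> \<open>The limit function is positive on this compact set, hence bounded below by
      some e. A point of \<open>A (r n)\<close> outside W would have distance 0 to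
      \<open>A (r n)\<close>, against uniform convergence.\<close>
    have "\<exists>e>0. \<forall>x\<in>?S - W. e \<le> f x"
    proof (cases "?S - W = {}")
      case False
      have "compact (?S - W)" using W(1) by (intro compact_diff) auto
      then obtain x where x: "x \<in> ?S - W" "\<forall>y\<in>?S - W. f x \<le> f y"
        using continuous_attains_inf[OF _ False continuous_on_subset[OF cont]] by blast
      then have "f x \<noteq> 0" using W(2) by (auto simp: C_def)
      then show ?thesis using x f_nonneg[of x] by (intro exI[of _ "f x"]) auto
    qed (auto intro: exI[of _ 1])
    then obtain e where e: "0 < e" "\<And>x. x \<in> ?S - W \<Longrightarrow> e \<le> f x" by blast
    from ev[OF e(1)] show ?thesis
    proof eventually_elim
      case (elim n)
      show ?case
      proof
        fix x assume x: "x \<in> A (r n)"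
        then have "x \<in> ?S" "infdist x (A (r n)) = 0" using A(3)[of "r n"] by auto
        then have "\<bar>0 - f x\<bar> < e" using elim by metis
        then have "f x < e" by linarith
        then show "x \<in> W" using e(2)[of x] \<open>x \<in> ?S\<close> by (meson Diff_iff not_less)
      qed
    qed
  qed
  \<comment> \<open>Otherwise outer regularity yields an open W around C of volume below \<delta>,
    and W eventually contains \<open>A (r n)\<close>.\<close>
  have "\<not> negligible C"
  proof
    assume neg: "negligible C"
    obtain W where W: "open W" "C \<subseteq> W" "W - C \<in> lmeasurable" "emeasure lebesgue (W - C) < ennreal \<delta>"
      using sets_lebesgue_outer_open[OF _ vol(3), of C] neg negligible_imp_sets by blast
    have "W = (W - C) \<union> C" using W(2) by auto
    have "C \<in> lmeasurable" using neg by (rule negligible_imp_measurable)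
    then have Wm: "W \<in> lmeasurable" using W(3) \<open>W = (W - C) \<union> C\<close> by (metis fmeasurable.Un)
    have "measure lebesgue W \<le> measure lebesgue (W - C) + measure lebesgue C"
      using measure_Un_le[of "W - C" lebesgue C] W(3) \<open>C \<in> lmeasurable\<close> \<open>W = (W - C) \<union> C\<close> by auto
    also have "measure lebesgue C = 0" using neg by (rule negligible_imp_measure0)
    also have "measure lebesgue (W - C) + 0 < \<delta>"
      using W(3,4) vol(3) by (simp add: emeasure_eq_measure2 ennreal_less_iff)
    finally have "measure lebesgue W < \<delta>" .
    moreover obtain n where "A (r n) \<subseteq> W" using eventually_happens[OF outer[OF W(1,2)]] by auto
    then have "measure lebesgue (A (r n)) \<le> measure lebesgue W"
      using vol(1)[of "r n"] Wm by (intro measure_mono_fmeasurable) auto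
    ultimately show False using vol(2)[of "r n"] by linarith
  qed
  then have int: "interior C \<noteq> {}" using negligible_convex_interior[OF \<open>convex C\<close>] by simp
  have "convex_domain (interior C)"
    using int \<open>convex C\<close> bounded_subset[OF bounded_cball CS] bounded_subset[OF _ interior_subset]
    by (auto simp: convex_domain_def convex_interior)
  moreover have "\<exists>e>0. eventually (\<lambda>n. ball x e \<subseteq> A (r n)) sequentially" if x: "x \<in> interior C" for x
  proof -
    obtain e where e: "0 < e" "ball x e \<subseteq> C" using x by (auto simp: mem_interior)
    then have "0 < e / 4" by simp
    have "eventually (\<lambda>n. ball x (e / 2) \<subseteq> A (r n)) sequentially"
      using near[OF \<open>0 < e / 4\<close>]
    proof eventually_elim
      case (elim n)
      show ?case
      proof (rule ccontr)
        assume "\<not> ?case"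
        then obtain y where y: "dist x y < e / 2" "y \<notin> A (r n)"
          unfolding subset_iff mem_ball by blast
        obtain a b where ab: "a \<noteq> 0" "\<forall>z\<in>A (r n). a \<bullet> z \<le> b" "b \<le> a \<bullet> y"
          using separating_hyperplane_sets[OF A(2) _ A(1), of "{y}" "r n"] y(2) by auto
        \<comment> \<open>A hyperplane with normal a separates y from \<open>A (r n)\<close>. Moving
          y by e/4 along a stays within 3/4 e of x, hence in C, but puts a distance of at least e/4
          to \<open>A (r n)\<close>, contradicting \<open>near\<close>.\<close>
        define w where "w = y + (e / 4 / norm a) *\<^sub>R a"
        have "dist y w = e / 4" using ab(1) e(1) by (simp add: w_def dist_norm)
        then have "w \<in> C" using y(1) e dist_triangle[of x w y] by (intro subsetD[OF e(2)]) auto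
        then obtain z where z: "z \<in> A (r n)" "dist w z < e / 4" using elim by (meson bspec)
        have "a \<bullet> w = a \<bullet> y + e / 4 / norm a * (a \<bullet> a)"
          by (simp add: w_def inner_add_right)
        also have "e / 4 / norm a * (a \<bullet> a) = e / 4 * norm a"
          using ab(1) by (simp add: dot_square_norm power2_eq_square)
        finally have "a \<bullet> w = a \<bullet> y + e / 4 * norm a" .
        then have "e / 4 * norm a \<le> a \<bullet> (w - z)"
          using ab(2,3) z(1) by (force simp: inner_diff_right)
        also have "\<dots> \<le> norm a * norm (w - z)" by (rule norm_cauchy_schwarz)
        also have "\<dots> < norm a * (e / 4)" using z(2) ab(1) by (simp add: dist_norm)
        finally show False by (simp add: mult.commute)
      qed
    qed
    then show ?thesis using e(1) by (intro exI[of _ "e / 2"]) auto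
  qed
  moreover have "closure (interior C) = C"
    using convex_closure_interior[OF \<open>convex C\<close> int] \<open>closed C\<close> by simp
  ultimately show ?thesis using that[OF r] outer by presburger
qed


subsection \<open>Existence of a maximizer\<close>

text \<open>For p < q the exponent of the volume is positive: at unit diameter, small volume forces
  small \<open>mu\<close>, so a maximizing sequence with positive limit cannot collapse.\<close>

lemma mu_le_const_times_measure:
  assumes "1 < p" "p < q"
  obtains C where "0 < C"
    and "\<And>\<Omega> :: 'a::euclidean_space set. convex_domain \<Omega> \<Longrightarrow> diameter \<Omega> = 1 \<Longrightarrow>
      mu p q \<Omega> \<le> C * measure lebesgue \<Omega> powr (1 - p / q)"
proof
  let ?c = "(1 / 8) powr q / 4 ^ DIM('a)"
  show "0 < 1 / ?c powr (p / q)" by simp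
  fix \<Omega> :: "'a set" assume \<Omega>: "convex_domain \<Omega>" "diameter \<Omega> = 1"
  let ?m = "measure lebesgue \<Omega>"
  have "mu p q \<Omega> \<le> ?m / ((1 / 8) powr q * (?m / 4 ^ DIM('a))) powr (p / q)"
    using convex_domain_mu_le(2)[of p q \<Omega>] assms \<Omega> by simp
  also have "(1 / 8) powr q * (?m / 4 ^ DIM('a)) = ?c * ?m" by simp
  also have "(?c * ?m) powr (p / q) = ?c powr (p / q) * ?m powr (p / q)"
    by (rule powr_mult)
  also have "?m / (?c powr (p / q) * ?m powr (p / q)) = 1 / ?c powr (p / q) * (?m / ?m powr (p / q))"
    by simp
  also have "?m / ?m powr (p / q) = ?m powr (1 - p / q)"
    by (cases "?m = 0") (auto simp: powr_diff less_le)
  finally show "mu p q \<Omega> \<le> 1 / ?c powr (p / q) * ?m powr (1 - p / q)" .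
qed

lemma convex_domain_unit_ball: "convex_domain (ball (0::'a::euclidean_space) (1 / 2))"
  "diameter (ball (0::'a::euclidean_space) (1 / 2)) = 1"
  by (auto simp: convex_domain_def)

text \<open>The inequality 1 \<le> diameter K suffices for the application: \<open>mu\<close> is
  nonnegative and s > 0, so a larger diameter can only raise the scale-invariant product.\<close>

lemma exists_mu_maximizer:
  assumes p: "1 < p" "p < q"
  shows "\<exists>K :: 'a::euclidean_space set. convex_domain K \<and> 1 \<le> diameter K \<and>
    (\<forall>\<Omega> :: 'a set. convex_domain \<Omega> \<longrightarrow> diameter \<Omega> = 1 \<longrightarrow> mu p q \<Omega> \<le> mu p q K)"
proof -
  have q: "1 < q" using p by simp
  let ?s = "p + DIM('a) * p / q - DIM('a)"
  \<comment> \<open>Requiring 0 \<in> \<Omega> removes the translations and confines all sets to the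
    closed unit ball, as the selection theorem demands.\<close>
  define \<A> where "\<A> = {\<Omega> :: 'a set. convex_domain \<Omega> \<and> diameter \<Omega> = 1 \<and> 0 \<in> \<Omega>}"
  define S where "S = Sup (mu p q ` \<A>)"
  have ball1: "cball x 1 \<in> lmeasurable" "measure lebesgue (cball x 1) = unit_ball_vol (real DIM('a))" for x :: 'a
    using content_cball[of 1 x] by (auto simp: lmeasurable_cball)
  obtain C where C: "0 < C" "\<And>\<Omega> :: 'a set. convex_domain \<Omega> \<Longrightarrow> diameter \<Omega> = 1 \<Longrightarrow>
      mu p q \<Omega> \<le> C * measure lebesgue \<Omega> powr (1 - p / q)"
    using mu_le_const_times_measure[OF p] by metis
  have pq: "0 < 1 - p / q" using p by simp
  have A_cball: "\<Omega> \<subseteq> cball 0 1" if "\<Omega> \<in> \<A>" for \<Omega>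
    using that diameter_bounded_bound[of \<Omega> 0] by (auto simp: \<A>_def convex_domain_def)
  have A_meas: "\<Omega> \<in> lmeasurable" if "\<Omega> \<in> \<A>" for \<Omega>
    using that lmeasurable_open_bounded(1)[of \<Omega>] by (auto simp: \<A>_def convex_domain_def)
  have bdd: "bdd_above (mu p q ` \<A>)"
  proof (rule bdd_aboveI2)
    fix \<Omega> assume \<Omega>: "\<Omega> \<in> \<A>"
    have "measure lebesgue \<Omega> \<le> unit_ball_vol (real DIM('a))"
      using measure_mono_fmeasurable[OF A_cball[OF \<Omega>] _ ball1(1)] A_meas[OF \<Omega>] ball1(2)[of 0] by auto
    then have "C * measure lebesgue \<Omega> powr (1 - p / q) \<le> C * unit_ball_vol (real DIM('a)) powr (1 - p / q)"
      using C(1) pq by (intro mult_left_mono powr_mono2) auto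
    then show "mu p q \<Omega> \<le> C * unit_ball_vol (real DIM('a)) powr (1 - p / q)"
      using C(2)[of \<Omega>] \<Omega> by (simp add: \<A>_def)
  qed
  have ne: "\<A> \<noteq> {}" using convex_domain_unit_ball[where 'a='a] by (auto simp: \<A>_def intro!: exI[of _ "ball 0 (1 / 2)"])
  have le_S: "mu p q \<Omega> \<le> S" if \<Omega>: "convex_domain \<Omega>" "diameter \<Omega> = 1" for \<Omega> :: "'a set"
  proof -
    obtain x where x: "x \<in> \<Omega>" using \<Omega>(1) by (auto simp: convex_domain_def)
    let ?V = "(\<lambda>y. x + 1 *\<^sub>R y) -` \<Omega>"
    have "?V \<in> \<A>"
      using convex_domain_vimage_affine[of 1 \<Omega> x] diameter_vimage_affine[of 1 \<Omega> x] \<Omega> x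
      by (simp add: \<A>_def convex_domain_def)
    then have "mu p q ?V \<le> S" unfolding S_def by (intro cSup_upper bdd) auto
    then show ?thesis using mu_affine[OF p(1) q \<Omega>(1), of 1 x] by simp
  qed
  show ?thesis
  proof (cases "S \<le> 0")
    \<comment> \<open>As \<open>mu\<close> is nonnegative, every set of diameter 1 is maximal here.
      The volume bound of the other case needs S > 0.\<close>
    case True
    then have "mu p q \<Omega> \<le> mu p q (ball (0::'a) (1 / 2))" if "convex_domain \<Omega>" "diameter \<Omega> = 1" for \<Omega> :: "'a set"
      using le_S[OF that] mu_nonneg[OF p(1) q convex_domain_unit_ball(1), where 'a='a] by linarith
    then show ?thesis using convex_domain_unit_ball[where 'a='a] by (intro exI[of _ "ball 0 (1 / 2)"]) auto
  next
    case False
    then have S: "0 < S" by simp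
    \<comment> \<open>The gap to S is at most S / 2, so \<open>mu\<close> exceeds S / 2 from n = 0
      on, and the volume bound below holds along the whole sequence.\<close>
    have "\<exists>\<Omega>\<in>\<A>. S - S / 2 / real (Suc n) < mu p q \<Omega>" for n
    proof -
      have "S - S / 2 / real (Suc n) < Sup (mu p q ` \<A>)"
        using S unfolding S_def[symmetric] by simp
      then show ?thesis using ne bdd by (subst (asm) less_cSup_iff) auto
    qed
    then obtain \<Omega> where \<Omega>: "\<And>n. \<Omega> n \<in> \<A>" "\<And>n. S - S / 2 / real (Suc n) < mu p q (\<Omega> n)" by metis
    have \<Omega>': "convex_domain (\<Omega> n)" "diameter (\<Omega> n) = 1" for n using \<Omega>(1) by (auto simp: \<A>_def)
    \<comment> \<open>The solution of C \<delta>^(1 - p / q) = S / 2; a smaller volume would force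
      \<open>mu\<close> \<le> S / 2.\<close>
    define \<delta> where "\<delta> = (S / 2 / C) powr (1 / (1 - p / q))"
    have \<delta>: "0 < \<delta>" "C * \<delta> powr (1 - p / q) = S / 2"
      using S C(1) pq by (auto simp: \<delta>_def powr_powr)
    have vol: "\<delta> \<le> measure lebesgue (\<Omega> n)" for n
    proof (rule ccontr)
      assume "\<not> ?thesis"
      then have "measure lebesgue (\<Omega> n) powr (1 - p / q) \<le> \<delta> powr (1 - p / q)"
        using pq by (intro powr_mono2) auto
      then have "C * measure lebesgue (\<Omega> n) powr (1 - p / q) \<le> S / 2"
        using mult_left_mono[of _ _ C] C(1) \<delta>(2) by fastforce
      moreover have "S / 2 / real (Suc n) \<le> S / 2"
        using S by (intro divide_le_eq[THEN iffD2]) auto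
      ultimately show False using C(2)[OF \<Omega>'] \<Omega>(2)[of n] by (smt (verit) field_sum_of_halves)
    qed
    have lim: "(\<lambda>n. mu p q (\<Omega> n)) \<longlonglongrightarrow> S"
    proof (rule tendsto_sandwich)
      show "(\<lambda>n. S - S / 2 / real (Suc n)) \<longlonglongrightarrow> S"
        using tendsto_diff[OF tendsto_const[of S] LIMSEQ_Suc[OF lim_const_over_n[of "S / 2"]]] by simp
      show "(\<lambda>n. S) \<longlonglongrightarrow> S" by simp
    qed (use \<Omega>(2) le_S[OF \<Omega>'] in \<open>auto intro!: always_eventually less_imp_le\<close>)
    obtain r K where r: "strict_mono r" and K: "convex_domain K"
      and inner: "\<And>x. x \<in> K \<Longrightarrow> \<exists>e>0. eventually (\<lambda>n. ball x e \<subseteq> \<Omega> (r n)) sequentially"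
      and outer: "\<And>W. open W \<Longrightarrow> closure K \<subseteq> W \<Longrightarrow> eventually (\<lambda>n. \<Omega> (r n) \<subseteq> W) sequentially"
    proof (rule Blaschke_selection[of \<Omega> 1 \<delta>])
      show "\<Omega> n \<noteq> {}" "convex (\<Omega> n)" for n using \<Omega>'(1)[of n] by (auto simp: convex_domain_def)
    qed (use A_cball A_meas \<Omega>(1) vol \<delta>(1) in auto)
    have K': "open K" "bounded K" "convex K" "K \<noteq> {}" using K by (auto simp: convex_domain_def)
    obtain a where a: "a \<in> K" using K'(4) by blast
    \<comment> \<open>The offset 2 keeps \<open>t k\<close> strictly between 0 and 1, also at k =
      0.\<close>
    define t where "t = (\<lambda>k. 1 - 1 / real (k + 2))"
    have t: "0 < t k" "t k < 1" for k by (auto simp: t_def)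
    have t_lim: "t \<longlonglongrightarrow> 1"
      unfolding t_def using tendsto_diff[OF tendsto_const LIMSEQ_ignore_initial_segment[OF lim_1_over_n, of 2]]
      by simp
    define b where "b = (\<lambda>k. (1 - t k) *\<^sub>R a)"
    \<comment> \<open>The dilation of K about a by the factor 1 / \<open>t k\<close>. Since a is an
      interior point, it is an open neighbourhood of the closure of K.\<close>
    define W where "W = (\<lambda>k. (\<lambda>x. b k + t k *\<^sub>R x) -` K)"
    have "eventually (\<lambda>n. \<Omega> (r n) \<subseteq> W k) sequentially" for k
    proof (rule outer)
      show "open (W k)"
        unfolding W_def using K'(1) by (intro open_vimage continuous_intros)
      show "closure K \<subseteq> W k"
      proof
        fix x assume "x \<in> closure K"
        then have "x - (1 - t k) *\<^sub>R (x - a) \<in> interior K"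
          using a K'(1) t[of k] mem_interior_closure_convex_shrink[OF K'(3), of a x "1 - t k"]
          by (simp add: interior_open)
        moreover have "x - (1 - t k) *\<^sub>R (x - a) = b k + t k *\<^sub>R x"
          by (simp add: b_def algebra_simps)
        ultimately show "x \<in> W k" using interior_subset by (auto simp: W_def)
      qed
    qed
    \<comment> \<open>A diagonal choice: one index for each neighbourhood \<open>W k\<close>, at
      least k so that the indices tend to infinity.\<close>
    then have "\<exists>n\<ge>k. \<Omega> (r n) \<subseteq> W k" for k
      unfolding eventually_sequentially by (meson nat_le_linear)
    then obtain m where m: "\<And>k. k \<le> m k" "\<And>k. \<Omega> (r (m k)) \<subseteq> W k" by metis
    have m_top: "filterlim m at_top sequentially"
      unfolding filterlim_at_top eventually_sequentially using m(1) order_trans by blast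
    have rm_top: "filterlim (\<lambda>k. r (m k)) at_top sequentially"
      using filterlim_compose[OF filterlim_subseq[OF r] m_top] .
    \<comment> \<open>The image of the chosen set under the contraction towards a that maps
      \<open>W k\<close> onto K, hence a subset of K.\<close>
    define U where "U = (\<lambda>k. (\<lambda>x. - (b k /\<^sub>R t k) + (1 / t k) *\<^sub>R x) -` \<Omega> (r (m k)))"
    have tn0: "t k \<noteq> 0" for k using t(1)[of k] by simp
    have "S \<le> mu p q K"
    proof (rule mu_upper_semicontinuous[OF p(1) q K])
      have "convex_domain (U k)" for k
        unfolding U_def using t(1)[of k] \<Omega>'(1) by (intro convex_domain_vimage_affine) auto
      then show "open (U k)" for k by (simp add: convex_domain_def)
      show "U k \<subseteq> K" for k
        using vimage_mono[OF m(2)[of k], of "\<lambda>x. - (b k /\<^sub>R t k) + (1 / t k) *\<^sub>R x"]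
        unfolding U_def W_def vimage_affine_vimage[OF tn0] .
      show "eventually (\<lambda>k. x \<in> U k) sequentially" if x: "x \<in> K" for x
      proof -
        obtain e where e: "0 < e" "eventually (\<lambda>n. ball x e \<subseteq> \<Omega> (r n)) sequentially"
          using inner[OF x] by blast
        \<comment> \<open>The point x is in \<open>U k\<close> iff its preimage under the
          contraction is in the chosen set. These preimages tend to x and so enter the ball supplied
          by \<open>inner\<close>.\<close>
        have "(\<lambda>k. - (b k /\<^sub>R t k) + (1 / t k) *\<^sub>R x) \<longlonglongrightarrow> - (((1 - 1) *\<^sub>R a) /\<^sub>R 1) + (1 / 1) *\<^sub>R x"
          unfolding b_def by (intro tendsto_intros t_lim) auto
        then have "(\<lambda>k. - (b k /\<^sub>R t k) + (1 / t k) *\<^sub>R x) \<longlonglongrightarrow> x" by simp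
        then have "eventually (\<lambda>k. dist (- (b k /\<^sub>R t k) + (1 / t k) *\<^sub>R x) x < e) sequentially"
          using e(1) by (rule tendstoD)
        moreover have "eventually (\<lambda>k. ball x e \<subseteq> \<Omega> (r (m k))) sequentially"
          using m_top e(2) by (rule filterlim_iff[THEN iffD1, rule_format])
        ultimately show ?thesis
          by eventually_elim (auto simp: U_def dist_commute)
      qed
      have "mu p q (U k) = (1 / t k) powr ?s * mu p q (\<Omega> (r (m k)))" for k
        unfolding U_def using t(1)[of k] \<Omega>'(1) by (intro mu_affine p(1) q) auto
      moreover have "(\<lambda>k. (1 / t k) powr ?s * mu p q (\<Omega> (r (m k)))) \<longlonglongrightarrow> (1 / 1) powr ?s * S"
        by (intro tendsto_mult tendsto_powr tendsto_divide tendsto_const t_lim filterlim_compose[OF lim rm_top]) auto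
      ultimately show "(\<lambda>k. mu p q (U k)) \<longlonglongrightarrow> S" by simp
    qed
    \<comment> \<open>\<open>W k\<close> contains a set of diameter 1, and its own diameter is that
      of K divided by \<open>t k\<close>.\<close>
    moreover have "1 \<le> diameter K"
    proof (rule tendsto_upperbound[OF t_lim])
      have "t k \<le> diameter K" for k
      proof -
        have "convex_domain (W k)"
          unfolding W_def using t(1)[of k] K by (intro convex_domain_vimage_affine) auto
        then have "1 \<le> diameter (W k)"
          using diameter_subset[OF m(2)[of k]] \<Omega>'(2) by (auto simp: convex_domain_def)
        also have "diameter (W k) = diameter K / t k"
          unfolding W_def using t(1)[of k] K'(2) by (rule diameter_vimage_affine)
        finally show ?thesis using t(1)[of k] by (simp add: le_divide_eq)
      qed
      then show "eventually (\<lambda>k. t k \<le> diameter K) sequentially" by (simp add: always_eventually)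
    qed simp
    ultimately show ?thesis
      using K le_S by (intro exI[of _ K]) (auto intro: order_trans)
  qed
qed

text \<open>For p < N the condition q < N p / (N - p) rearranges to the claim; for p \<ge> N the
  terms p - N and N p / q are nonnegative and not both 0.\<close>

lemma diameter_exponent_pos:
  fixes p q :: real
  assumes "1 < p" "p < q" "ereal q < sobolev_exponent N p"
  shows "0 < p + real N * p / q - real N"
proof (cases "p < real N")
  case True
  then have "q < real N * p / (real N - p)"
    using assms(3) by (simp add: sobolev_exponent_def)
  then have "q * (real N - p) < real N * p"
    using True by (simp add: less_divide_eq)
  then show ?thesis using assms(1,2) by (simp add: field_simps)
next
  case False
  have "0 < p * (q + real N) - real N * q \<or> real N = 0"
  proof (cases "N = 0")
    case False
    then have "real N * q \<le> p * q" "0 < p * real N"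
      using \<open>\<not> p < real N\<close> assms(1,2) by (auto intro: mult_right_mono)
    then show ?thesis by (simp add: algebra_simps)
  qed simp
  then show ?thesis using assms(1,2) by (auto simp: field_simps)
qed

theorem theorem4p4:
  fixes p q :: real
  assumes "1 < p" and "p < q" and "ereal q < sobolev_exponent DIM('a::euclidean_space) p"
  shows "(\<forall>c>0. \<exists>K::'a set. convex_domain K \<and> diameter K \<ge> c \<and>
            (\<forall>\<Omega>::'a set. convex_domain \<Omega> \<and> diameter \<Omega> \<ge> c \<longrightarrow> mu p q \<Omega> \<le> mu p q K)) \<and>
         (\<exists>K::'a set. convex_domain K \<and>
            (\<forall>\<Omega>::'a set. convex_domain \<Omega> \<longrightarrow>
               mu p q \<Omega> * diameter \<Omega> powr (p + DIM('a) * p / q - DIM('a))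
                 \<le> mu p q K * diameter K powr (p + DIM('a) * p / q - DIM('a))))"
proof -
  define s where "s = p + DIM('a) * p / q - DIM('a)"
  have s: "0 < s" unfolding s_def by (rule diameter_exponent_pos[OF assms])
  have q: "1 < q" using assms by simp
  have rescale: "convex_domain ((\<lambda>x. 0 + (diameter \<Omega> / d) *\<^sub>R x) -` \<Omega>)"
      "diameter ((\<lambda>x. 0 + (diameter \<Omega> / d) *\<^sub>R x) -` \<Omega>) = d"
      "mu p q ((\<lambda>x. 0 + (diameter \<Omega> / d) *\<^sub>R x) -` \<Omega>) = mu p q \<Omega> * (diameter \<Omega> / d) powr s"
    if "convex_domain \<Omega>" "0 < d" for \<Omega> :: "'a set" and d
  proof -
    have D: "bounded \<Omega>" "0 < diameter \<Omega> / d" "diameter \<Omega> \<noteq> 0"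
      using that diameter_open_pos[of \<Omega>] by (auto simp: convex_domain_def)
    show "convex_domain ((\<lambda>x. 0 + (diameter \<Omega> / d) *\<^sub>R x) -` \<Omega>)"
      by (rule convex_domain_vimage_affine[OF D(2) that(1)])
    show "diameter ((\<lambda>x. 0 + (diameter \<Omega> / d) *\<^sub>R x) -` \<Omega>) = d"
      using diameter_vimage_affine[OF D(2,1), of 0] D(3) by simp
    show "mu p q ((\<lambda>x. 0 + (diameter \<Omega> / d) *\<^sub>R x) -` \<Omega>) = mu p q \<Omega> * (diameter \<Omega> / d) powr s"
      unfolding mu_affine[OF assms(1) q that(1) D(2)] s_def by (rule mult.commute)
  qed
  obtain K :: "'a set" where K: "convex_domain K" "1 \<le> diameter K"
    and max: "\<And>\<Omega> :: 'a set. convex_domain \<Omega> \<Longrightarrow> diameter \<Omega> = 1 \<Longrightarrow> mu p q \<Omega> \<le> mu p q K"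
    using exists_mu_maximizer[OF assms(1,2), where 'a='a] by blast
  have main: "mu p q \<Omega> * diameter \<Omega> powr s \<le> mu p q K * diameter K powr s" if \<Omega>: "convex_domain \<Omega>" for \<Omega> :: "'a set"
  proof -
    have "mu p q \<Omega> * diameter \<Omega> powr s \<le> mu p q K * 1 powr s"
      using max[OF rescale(1,2)[OF \<Omega>]] rescale(3)[OF \<Omega>, of 1] by simp
    also have "\<dots> \<le> mu p q K * diameter K powr s"
      using K s mu_nonneg[OF assms(1) q K(1)] by (intro mult_left_mono powr_mono2) auto
    finally show ?thesis .
  qed
  have "\<exists>K'::'a set. convex_domain K' \<and> diameter K' \<ge> c \<and>
            (\<forall>\<Omega>::'a set. convex_domain \<Omega> \<and> diameter \<Omega> \<ge> c \<longrightarrow> mu p q \<Omega> \<le> mu p q K')" if c: "0 < c" for c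
  proof (intro exI conjI allI impI)
    \<comment> \<open>K is brought to diameter exactly c: as s > 0, enlarging a set by dilation
      cannot raise \<open>mu\<close>, so the constraint is best met with equality.\<close>
    let ?K = "(\<lambda>x. 0 + (diameter K / c) *\<^sub>R x) -` K"
    show "convex_domain ?K" "c \<le> diameter ?K" using rescale(1,2)[OF K(1) c] by auto
    fix \<Omega> :: "'a set" assume \<Omega>: "convex_domain \<Omega> \<and> c \<le> diameter \<Omega>"
    have "mu p q \<Omega> * c powr s \<le> mu p q \<Omega> * diameter \<Omega> powr s"
      using \<Omega> c s mu_nonneg[OF assms(1) q, of \<Omega>] by (intro mult_left_mono powr_mono2) auto
    also have "\<dots> \<le> mu p q K * diameter K powr s" using main \<Omega> by blast
    finally have "mu p q \<Omega> \<le> mu p q K * diameter K powr s / c powr s"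
      using c by (simp add: le_divide_eq)
    also have "\<dots> = mu p q ?K"
      using rescale(3)[OF K(1) c] c K(2) by (simp add: powr_divide)
    finally show "mu p q \<Omega> \<le> mu p q ?K" .
  qed
  then show ?thesis using K(1) main unfolding s_def by blast
qed

end
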